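(* Let $S \colon |S| \to \mathsf{2}$ be a schema, i.e. a functor from a small category $|S|$ to the interval category $\mathsf{2} = \{0 \to 1\}$ such that the fiber $S_1 := S^{-1}(1)$ is a discrete category; let $\mathsf{C} := S_0 := S^{-1}(0)$, and let $K \colon S_1 \to \mathbf{Set}$ be a functor. Then the category $\mathbf{Acset}_K^S$ of $K$-typed acsets on $S$ has all finite limits. Moreover, these limits may be reduced to limits in $\mathbf{Set}^{\mathsf{C}}$ as follows. Let $D \colon \mathsf{C} \to \mathbf{Set}$ be a functor for which there is an isomorphism of categories $\Phi \colon \mathbf{Acset}_K^S \xrightarrow{\cong} \mathbf{Set}^{\mathsf{C}}/D$. Let $J$ be a finite category, $F \colon J \to \mathbf{Acset}_K^S$ a functor, and let $F' := \Phi \circ F \colon J \to \mathbf{Set}^{\mathsf{C}}/D$, with associated enlarged diagram $\overline{F'} \colon J_\bullet \to \mathbf{Set}^{\mathsf{C}}$. Then $\overline{F'}$ has a limit in $\mathbf{Set}^{\mathsf{C}}$, and any limit cone $(\lambda_j \colon L \to \overline{F'}(j))_{j \in J_\bullet}$ of $\overline{F'}$ lifts uniquely to a limit cone of $F'$ in $\mathbf{Set}^{\mathsf{C}}/D$, whose apex is the object $\lambda_\bullet \colon L \to D$ and whose legs are the $\lambda_j$, $j \in J$; applying $\Phi^{-1}$ to this cone gives a limit cone of $F$.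
   Context: For a functor $S \colon |S| \to \mathsf{2}$, where $\mathsf{2} = \{0 \to 1\}$ is the category with two objects and one non-identity morphism $0 \to 1$, the fiber $S_i = S^{-1}(i)$ is the subcategory of $|S|$ of objects sent to $i$ and morphisms sent to $\mathrm{id}_i$. An acset on a schema $S$ with typing map $K \colon S_1 \to \mathbf{Set}$ is a functor $G \colon |S| \to \mathbf{Set}$ whose restriction to $S_1$ equals $K$. A morphism of acsets $G_1 \to G_2$ (with the same typing map $K$) is a natural transformation $\alpha \colon G_1 \Rightarrow G_2$ such that $\alpha|_{S_1}$ is the identity transformation on $K$. These objects and morphisms form the category $\mathbf{Acset}_K^S$. It is known that this category is isomorphic to a slice category $\mathbf{Set}^{\mathsf{C}}/D$ for some $\mathsf{C}$-set $D$ (functor $D \colon \mathsf{C} \to \mathbf{Set}$). Enlarged diagram: given a category $\mathsf{D}$, an object $d \in \mathsf{D}$ and a diagram $F \colon J \to \mathsf{D}/d$, let $J_\bullet$ be the category obtained from $J$ by freely adjoining a terminal object, i.e. a new object $\bullet$ and, for each object $j$ of $J$, a unique morphism $j_\bullet \colon j \to \bullet$. Define $\overline{F} \colon J_\bullet \to \mathsf{D}$ by $\overline{F}(\bullet) = d$, $\overline{F}(j_\bullet) = F(j)$ (the object $F(j)$ of $\mathsf{D}/d$ being regarded as a morphism of $\mathsf{D}$ with codomain $d$) for each $j \in J$, and $\overline{F}|_J = \Pi \circ F$, where $\Pi \colon \mathsf{D}/d \to \mathsf{D}$ is the forgetful functor. *)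

theory Defs
  imports Main "HOL-Library.FuncSet" "HOL-Library.Equipollence"
begin

section \<open>Categories\<close>

text \<open>\<open>Comp C g f\<close> is the composite of \<open>f\<close> followed by \<open>g\<close>. Composition outside composable
  pairs, and \<open>Dom\<close>, \<open>Cod\<close>, \<open>Ident\<close> outside \<open>Arr\<close> and \<open>Obj\<close>, are irrelevant.\<close>

record ('o, 'a) cat =
  Obj :: "'o set"
  Arr :: "'a set"
  Dom :: "'a \<Rightarrow> 'o"
  Cod :: "'a \<Rightarrow> 'o"
  Ident :: "'o \<Rightarrow> 'a"
  Comp :: "'a \<Rightarrow> 'a \<Rightarrow> 'a"

definition hom :: "('o, 'a) cat \<Rightarrow> 'o \<Rightarrow> 'o \<Rightarrow> 'a set" where
  "hom C x y = {f \<in> Arr C. Dom C f = x \<and> Cod C f = y}"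

locale category =
  fixes C :: "('o, 'a) cat"
  assumes Dom_in: "f \<in> Arr C \<Longrightarrow> Dom C f \<in> Obj C"
    and Cod_in: "f \<in> Arr C \<Longrightarrow> Cod C f \<in> Obj C"
    and Ident_in: "x \<in> Obj C \<Longrightarrow> Ident C x \<in> hom C x x"
    and Comp_in: "f \<in> hom C x y \<Longrightarrow> g \<in> hom C y z \<Longrightarrow> Comp C g f \<in> hom C x z"
    and Ident_left: "f \<in> hom C x y \<Longrightarrow> Comp C (Ident C y) f = f"
    and Ident_right: "f \<in> hom C x y \<Longrightarrow> Comp C f (Ident C x) = f"
    and Comp_assoc: "f \<in> hom C w x \<Longrightarrow> g \<in> hom C x y \<Longrightarrow> h \<in> hom C y z \<Longrightarrow>
      Comp C h (Comp C g f) = Comp C (Comp C h g) f"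

definition finite_category :: "('o, 'a) cat \<Rightarrow> bool" where
  "finite_category C \<longleftrightarrow> category C \<and> finite (Obj C) \<and> finite (Arr C)"

definition discrete_category :: "('o, 'a) cat \<Rightarrow> bool" where
  "discrete_category C \<longleftrightarrow> category C \<and> Arr C = Ident C ` Obj C"

section \<open>Functors\<close>

text \<open>The two maps of a functor are extensional (\<open>undefined\<close> off the source category), so that
  HOL equality of \<open>func\<close> records is equality of functors.\<close>

record ('o, 'a, 'p, 'b) func =
  fobj :: "'o \<Rightarrow> 'p"
  farr :: "'a \<Rightarrow> 'b"

locale cat_functor = source: category C + target: category D
  for C :: "('o, 'a) cat" and D :: "('p, 'b) cat" +
  fixes F :: "('o, 'a, 'p, 'b) func"
  assumes fobj_in: "fobj F \<in> Obj C \<rightarrow>\<^sub>E Obj D"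
    and farr_ext: "farr F \<in> extensional (Arr C)"
    and farr_in: "f \<in> hom C x y \<Longrightarrow> farr F f \<in> hom D (fobj F x) (fobj F y)"
    and farr_Ident: "x \<in> Obj C \<Longrightarrow> farr F (Ident C x) = Ident D (fobj F x)"
    and farr_Comp: "f \<in> hom C x y \<Longrightarrow> g \<in> hom C y z \<Longrightarrow>
      farr F (Comp C g f) = Comp D (farr F g) (farr F f)"

definition id_func :: "('o, 'a) cat \<Rightarrow> ('o, 'a, 'o, 'a) func" where
  "id_func C = \<lparr>fobj = restrict id (Obj C), farr = restrict id (Arr C)\<rparr>"

text \<open>\<open>comp_func C G F\<close> is \<open>G \<circ> F\<close>, where \<open>C\<close> is the source category of \<open>F\<close>.\<close>

definition comp_func ::
  "('o, 'a) cat \<Rightarrow> ('p, 'b, 'q, 'c) func \<Rightarrow> ('o, 'a, 'p, 'b) func \<Rightarrow> ('o, 'a, 'q, 'c) func" where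
  "comp_func C G F =
    \<lparr>fobj = compose (Obj C) (fobj G) (fobj F), farr = compose (Arr C) (farr G) (farr F)\<rparr>"

text \<open>Restriction of a functor to a subcategory \<open>C'\<close> of its source.\<close>

definition restrict_func :: "('o, 'a, 'p, 'b) func \<Rightarrow> ('o, 'a) cat \<Rightarrow> ('o, 'a, 'p, 'b) func" where
  "restrict_func F C' = \<lparr>fobj = restrict (fobj F) (Obj C'), farr = restrict (farr F) (Arr C')\<rparr>"

text \<open>\<open>\<Phi>\<close> is an isomorphism of categories with inverse \<open>\<Psi>\<close>.\<close>

definition inverse_functors ::
  "('o, 'a) cat \<Rightarrow> ('p, 'b) cat \<Rightarrow> ('o, 'a, 'p, 'b) func \<Rightarrow> ('p, 'b, 'o, 'a) func \<Rightarrow> bool" where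
  "inverse_functors C D \<Phi> \<Psi> \<longleftrightarrow> cat_functor C D \<Phi> \<and> cat_functor D C \<Psi> \<and>
    comp_func C \<Psi> \<Phi> = id_func C \<and> comp_func D \<Phi> \<Psi> = id_func D"

section \<open>Functor categories and slice categories\<close>

text \<open>A morphism together with its endpoints, where these are not determined by the underlying data
  (maps of sets, families of components, morphisms over a base).\<close>

datatype ('o, 'm) arrow = Arrow (source: 'o) (under: 'm) (target: 'o)

locale nat_transf = F: cat_functor C D F + G: cat_functor C D G
  for C :: "('o, 'a) cat" and D :: "('p, 'b) cat" and F G +
  fixes \<alpha> :: "'o \<Rightarrow> 'b"
  assumes component_ext: "\<alpha> \<in> extensional (Obj C)"
    and component_in: "x \<in> Obj C \<Longrightarrow> \<alpha> x \<in> hom D (fobj F x) (fobj G x)"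
    and naturality: "f \<in> hom C x y \<Longrightarrow>
      Comp D (\<alpha> y) (farr F f) = Comp D (farr G f) (\<alpha> x)"

definition functor_cat :: "('o, 'a) cat \<Rightarrow> ('p, 'b) cat \<Rightarrow>
    (('o, 'a, 'p, 'b) func, (('o, 'a, 'p, 'b) func, 'o \<Rightarrow> 'b) arrow) cat" where
  "functor_cat C D =
    \<lparr>Obj = {F. cat_functor C D F},
     Arr = {Arrow F \<alpha> G | F \<alpha> G. nat_transf C D F G \<alpha>},
     Dom = source, Cod = target,
     Ident = (\<lambda>F. Arrow F (\<lambda>x\<in>Obj C. Ident D (fobj F x)) F),
     Comp = (\<lambda>\<beta> \<alpha>. Arrow (source \<alpha>) (\<lambda>x\<in>Obj C. Comp D (under \<beta> x) (under \<alpha> x)) (target \<beta>))\<rparr>"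

text \<open>An object of the slice \<open>D/d\<close> is a morphism of \<open>D\<close> with codomain \<open>d\<close>.\<close>

definition slice_cat :: "('o, 'a) cat \<Rightarrow> 'o \<Rightarrow> ('a, ('a, 'a) arrow) cat" where
  "slice_cat D d =
    \<lparr>Obj = {p \<in> Arr D. Cod D p = d},
     Arr = {Arrow p h q | p h q. p \<in> Arr D \<and> Cod D p = d \<and> q \<in> Arr D \<and> Cod D q = d \<and>
              h \<in> hom D (Dom D p) (Dom D q) \<and> Comp D q h = p},
     Dom = source, Cod = target,
     Ident = (\<lambda>p. Arrow p (Ident D (Dom D p)) p),
     Comp = (\<lambda>g f. Arrow (source f) (Comp D (under g) (under f)) (target g))\<rparr>"

definition slice_forget :: "('o, 'a) cat \<Rightarrow> 'o \<Rightarrow> ('a, ('a, 'a) arrow, 'o, 'a) func" where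
  "slice_forget D d =
    \<lparr>fobj = restrict (Dom D) (Obj (slice_cat D d)), farr = restrict under (Arr (slice_cat D d))\<rparr>"

section \<open>Limits\<close>

record ('j, 'o, 'a) cone =
  apex :: 'o
  leg :: "'j \<Rightarrow> 'a"

locale is_cone = diagram: cat_functor J D F
  for J :: "('j, 'k) cat" and D :: "('o, 'a) cat" and F +
  fixes M :: "('j, 'o, 'a) cone"
  assumes apex_in: "apex M \<in> Obj D"
    and leg_ext: "leg M \<in> extensional (Obj J)"
    and leg_in: "j \<in> Obj J \<Longrightarrow> leg M j \<in> hom D (apex M) (fobj F j)"
    and leg_natural: "f \<in> hom J i j \<Longrightarrow> Comp D (farr F f) (leg M i) = leg M j"

definition is_limit_cone where
  "is_limit_cone J D F M \<longleftrightarrow> is_cone J D F M \<and>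
    (\<forall>N. is_cone J D F N \<longrightarrow>
      (\<exists>!u. u \<in> hom D (apex N) (apex M) \<and> (\<forall>j\<in>Obj J. Comp D (leg M j) u = leg N j)))"

definition has_limit where
  "has_limit J D F \<longleftrightarrow> (\<exists>M. is_limit_cone J D F M)"

definition has_limits_of_shape where
  "has_limits_of_shape J D \<longleftrightarrow> category D \<and> (\<forall>F. cat_functor J D F \<longrightarrow> has_limit J D F)"

text \<open>The image under a functor \<open>G\<close> of a cone over a diagram of shape \<open>J\<close>.\<close>

definition image_cone ::
  "('j, 'k) cat \<Rightarrow> ('o, 'a, 'p, 'b) func \<Rightarrow> ('j, 'o, 'a) cone \<Rightarrow> ('j, 'p, 'b) cone" where
  "image_cone J G M = \<lparr>apex = fobj G (apex M), leg = (\<lambda>j\<in>Obj J. farr G (leg M j))\<rparr>"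

section \<open>Enlarged diagrams\<close>

text \<open>Adjoining a terminal object to \<open>J\<close>: \<open>None\<close> is the new object, \<open>To_new (Some j)\<close> is the
  unique morphism from \<open>j\<close> to it, and \<open>To_new None\<close> is its identity.\<close>

datatype ('j, 'k) term_arr = Old 'k | To_new "'j option"

definition adjoin_terminal :: "('j, 'k) cat \<Rightarrow> ('j option, ('j, 'k) term_arr) cat" where
  "adjoin_terminal J =
    \<lparr>Obj = insert None (Some ` Obj J),
     Arr = Old ` Arr J \<union> To_new ` insert None (Some ` Obj J),
     Dom = (\<lambda>f. case f of Old k \<Rightarrow> Some (Dom J k) | To_new x \<Rightarrow> x),
     Cod = (\<lambda>f. case f of Old k \<Rightarrow> Some (Cod J k) | To_new x \<Rightarrow> None),
     Ident = (\<lambda>x. case x of None \<Rightarrow> To_new None | Some j \<Rightarrow> Old (Ident J j)),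
     Comp = (\<lambda>g f. case f of
         Old k \<Rightarrow> (case g of Old l \<Rightarrow> Old (Comp J l k) | To_new x \<Rightarrow> To_new (Some (Dom J k)))
       | To_new x \<Rightarrow> To_new x)\<rparr>"

definition enlarged_diagram :: "('o, 'a) cat \<Rightarrow> 'o \<Rightarrow> ('j, 'k) cat \<Rightarrow>
    ('j, 'k, 'a, ('a, 'a) arrow) func \<Rightarrow> ('j option, ('j, 'k) term_arr, 'o, 'a) func" where
  "enlarged_diagram D d J F =
    \<lparr>fobj = (\<lambda>x\<in>Obj (adjoin_terminal J). case x of
         None \<Rightarrow> d
       | Some j \<Rightarrow> fobj (slice_forget D d) (fobj F j)),
     farr = (\<lambda>f\<in>Arr (adjoin_terminal J). case f of
         Old k \<Rightarrow> farr (slice_forget D d) (farr F k)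
       | To_new None \<Rightarrow> Ident D d
       | To_new (Some j) \<Rightarrow> fobj F j)\<rparr>"

text \<open>A cone \<open>M\<close> over a diagram \<open>F\<close> in \<open>D/d\<close> lifts a cone \<open>\<Lambda>\<close> over the enlarged diagram of \<open>F\<close>.
  The condition on the new object has to be imposed separately: if \<open>J\<close> is empty, the structure
  morphism of the apex of \<open>M\<close> is not determined by the other two conditions.\<close>

definition lifts_cone :: "('o, 'a) cat \<Rightarrow> 'o \<Rightarrow> ('j, 'k) cat \<Rightarrow>
    ('j, 'a, ('a, 'a) arrow) cone \<Rightarrow> ('j option, 'o, 'a) cone \<Rightarrow> bool" where
  "lifts_cone D d J M \<Lambda> \<longleftrightarrow>
    fobj (slice_forget D d) (apex M) = apex \<Lambda> \<and>
    apex M = leg \<Lambda> None \<and>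
    (\<forall>j\<in>Obj J. farr (slice_forget D d) (leg M j) = leg \<Lambda> (Some j))"

section \<open>Sets\<close>

text \<open>HOL has no type of all sets. The category of sets is taken with respect to a universe, that
  is, a collection \<open>U\<close> of (small) sets of elements of a type, subject to the closure properties of
  a Grothendieck universe. Since the elements of a HOL set are not themselves sets, the power set is
  only required to be small up to a bijection; closure under images follows from \<open>pair\<close> and
  \<open>union\<close>. An infinite member is not required, so the finite sets are also covered.\<close>

locale set_universe =
  fixes U :: "'u set set"
  assumes subset: "A \<in> U \<Longrightarrow> B \<subseteq> A \<Longrightarrow> B \<in> U"
    and pair: "{x, y} \<in> U"
    and union: "A \<in> U \<Longrightarrow> (\<And>a. a \<in> A \<Longrightarrow> I a \<in> U) \<Longrightarrow> (\<Union>a\<in>A. I a) \<in> U"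
    and pow: "A \<in> U \<Longrightarrow> \<exists>B\<in>U. Pow A \<approx> B"

lemma set_universe_finite: "set_universe {A :: nat set. finite A}"
proof
  fix A :: "nat set"
  assume "A \<in> {A. finite A}"
  then have "Pow A \<approx> {..<card (Pow A)}"
    by (simp add: eqpoll_iff_card)
  then show "\<exists>B\<in>{A :: nat set. finite A}. Pow A \<approx> B"
    by blast
qed (auto intro: finite_subset)

definition small :: "'u set set \<Rightarrow> 'b set \<Rightarrow> bool" where
  "small U X \<longleftrightarrow> (\<exists>A\<in>U. X \<approx> A)"

definition small_category :: "'u set set \<Rightarrow> ('o, 'a) cat \<Rightarrow> bool" where
  "small_category U C \<longleftrightarrow> category C \<and> small U (Obj C) \<and> small U (Arr C)"

definition set_cat :: "'u set set \<Rightarrow> ('u set, ('u set, 'u \<Rightarrow> 'u) arrow) cat" where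
  "set_cat U =
    \<lparr>Obj = U,
     Arr = {Arrow A f B | A f B. A \<in> U \<and> B \<in> U \<and> f \<in> A \<rightarrow>\<^sub>E B},
     Dom = source, Cod = target,
     Ident = (\<lambda>A. Arrow A (restrict id A) A),
     Comp = (\<lambda>g f. Arrow (source f) (compose (source f) (under g) (under f)) (target g))\<rparr>"

section \<open>Schemas and acsets\<close>

text \<open>The category \<open>0 \<rightarrow> 1\<close>; the morphism from \<open>i\<close> to \<open>j\<close> is the pair \<open>(i, j)\<close>.\<close>

definition interval_cat :: "(nat, nat \<times> nat) cat" where
  "interval_cat =
    \<lparr>Obj = {0, 1}, Arr = {(0, 0), (0, 1), (1, 1)}, Dom = fst, Cod = snd,
     Ident = (\<lambda>i. (i, i)), Comp = (\<lambda>g f. (fst f, snd g))\<rparr>"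

definition fiber :: "('o, 'a) cat \<Rightarrow> ('o, 'a, nat, nat \<times> nat) func \<Rightarrow> nat \<Rightarrow> ('o, 'a) cat" where
  "fiber X S i =
    X\<lparr>Obj := {x \<in> Obj X. fobj S x = i}, Arr := {f \<in> Arr X. farr S f = Ident interval_cat i}\<rparr>"

text \<open>A schema \<open>S\<close> on the category \<open>X\<close>, which is written \<open>|S|\<close> in informal notation.\<close>

definition schema ::
  "'u set set \<Rightarrow> ('o, 'a) cat \<Rightarrow> ('o, 'a, nat, nat \<times> nat) func \<Rightarrow> bool" where
  "schema U X S \<longleftrightarrow> small_category U X \<and> cat_functor X interval_cat S \<and>
    discrete_category (fiber X S 1)"

type_synonym ('o, 'a, 'u) setfunc = "('o, 'a, 'u set, ('u set, 'u \<Rightarrow> 'u) arrow) func"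

type_synonym ('o, 'a, 'u) settrans =
  "(('o, 'a, 'u) setfunc, 'o \<Rightarrow> ('u set, 'u \<Rightarrow> 'u) arrow) arrow"

definition is_acset :: "'u set set \<Rightarrow> ('o, 'a) cat \<Rightarrow> ('o, 'a, nat, nat \<times> nat) func \<Rightarrow>
    ('o, 'a, 'u) setfunc \<Rightarrow> ('o, 'a, 'u) setfunc \<Rightarrow> bool" where
  "is_acset U X S K G \<longleftrightarrow> cat_functor X (set_cat U) G \<and> restrict_func G (fiber X S 1) = K"

definition acset_cat :: "'u set set \<Rightarrow> ('o, 'a) cat \<Rightarrow> ('o, 'a, nat, nat \<times> nat) func \<Rightarrow>
    ('o, 'a, 'u) setfunc \<Rightarrow> (('o, 'a, 'u) setfunc, ('o, 'a, 'u) settrans) cat" where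
  "acset_cat U X S K = (functor_cat X (set_cat U))
    \<lparr>Obj := {G. is_acset U X S K G},
     Arr := {Arrow G \<alpha> H | G \<alpha> H. is_acset U X S K G \<and> is_acset U X S K H \<and>
       nat_transf X (set_cat U) G H \<alpha> \<and>
       (\<forall>s\<in>Obj (fiber X S 1). \<alpha> s = Ident (set_cat U) (fobj K s))}\<rparr>"

end

theory Submission imports Defs begin

text \<open>A limit cone over the enlarged diagram is the same thing as a limit cone in the slice: the leg
  at the new object is the structure morphism of the apex. Limits in \<open>Set\<^sup>C\<close> are pointwise, and
  fully faithful functors reflect limits, so the second claim is transported along \<open>\<Phi>\<close>.

  The category of acsets has a terminal object \<open>T\<close>, the product of the sets \<open>K s\<close> over all arrows
  \<open>x \<rightarrow> s\<close> to attribute types \<open>s \<in> S\<^sub>1\<close>. Sending \<open>G\<close> to the unique morphism \<open>G \<rightarrow> T\<close>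
  embeds acsets fully faithfully into the slice of \<open>Set\<^sup>X\<close> over \<open>T\<close>, because a morphism over \<open>T\<close> is
  forced to be the identity on \<open>S\<^sub>1\<close>. Hence the limit of a diagram of acsets is the limit of
  its enlarged diagram in \<open>Set\<^sup>X\<close>, once this is chosen to restrict to \<open>K\<close>.\<close>

section \<open>Categories and functors\<close>

text \<open>The slice over \<open>terminal_acset\<close> replaces it, and reflecting limits takes
  only full faithfulness. The price is that an object of this slice need not come from an acset: the
  image of the embedding consists of morphisms that are identities on S_1, and agreement with
  \<open>K\<close> is an equality, whereas an arbitrary limit agrees with \<open>K\<close> only up
  to bijection. Limits are therefore built with prescribed values at attribute types. Such a
  prescription is possible because the enlarged shape is connected, so that a constant diagram has
  its own value as limit. A second obstacle is the type of elements: products and sets of compatible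
  families are not sets over \<open>'u\<close>, so each such construction passes through an
  injective encoding onto a member of \<open>U\<close>.\<close>

lemma hom_iff: "f \<in> hom C x y \<longleftrightarrow> f \<in> Arr C \<and> Dom C f = x \<and> Cod C f = y"
  by (auto simp: hom_def)

lemma (in category) hom_objs:
  assumes "f \<in> hom C x y"
  shows "x \<in> Obj C" "y \<in> Obj C"
  using assms Dom_in Cod_in by (auto simp: hom_def)

lemma (in cat_functor) fobj_Obj: "x \<in> Obj C \<Longrightarrow> fobj F x \<in> Obj D"
  using fobj_in by auto

lemma cat_functor_comp_func:
  assumes "cat_functor C D F" "cat_functor D E G"
  shows "cat_functor C E (comp_func C G F)"
proof -
  interpret F: cat_functor C D F by fact
  interpret G: cat_functor D E G by fact
  show ?thesis
  proof
    show "fobj (comp_func C G F) \<in> Obj C \<rightarrow>\<^sub>E Obj E"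
      by (auto simp: comp_func_def compose_def F.fobj_Obj G.fobj_Obj)
    show "farr (comp_func C G F) \<in> extensional (Arr C)"
      by (auto simp: comp_func_def)
  next
    fix f x y assume f: "f \<in> hom C x y"
    then show "farr (comp_func C G F) f \<in> hom E (fobj (comp_func C G F) x) (fobj (comp_func C G F) y)"
      using F.source.hom_objs[OF f] G.farr_in[OF F.farr_in[OF f]]
      by (simp add: comp_func_def compose_def hom_iff)
  next
    fix x assume "x \<in> Obj C"
    then show "farr (comp_func C G F) (Ident C x) = Ident E (fobj (comp_func C G F) x)"
      using F.source.Ident_in[of x]
      by (simp add: comp_func_def compose_def hom_iff F.farr_Ident G.farr_Ident F.fobj_Obj)
  next
    fix f g x y z assume f: "f \<in> hom C x y" and g: "g \<in> hom C y z"
    then show "farr (comp_func C G F) (Comp C g f)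
        = Comp E (farr (comp_func C G F) g) (farr (comp_func C G F) f)"
      using F.source.Comp_in[OF f g] G.farr_Comp[OF F.farr_in[OF f] F.farr_in[OF g]]
        F.farr_Comp[OF f g]
      by (simp add: comp_func_def compose_def hom_iff)
  qed
qed

lemma limit_coneD:
  assumes "is_limit_cone J D F M" "is_cone J D F N"
  shows "\<exists>!u. u \<in> hom D (apex N) (apex M) \<and> (\<forall>j\<in>Obj J. Comp D (leg M j) u = leg N j)"
  using assms unfolding is_limit_cone_def by auto

section \<open>Images of cones and reflection of limits\<close>

lemma is_cone_image_cone:
  assumes "is_cone J C F M" "cat_functor C D G"
  shows "is_cone J D (comp_func J G F) (image_cone J G M)"
proof -
  interpret M: is_cone J C F M by fact
  interpret G: cat_functor C D G by fact
  interpret GF: cat_functor J D "comp_func J G F"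
    using M.diagram.cat_functor_axioms assms(2) by (rule cat_functor_comp_func)
  show ?thesis
  proof
    show "apex (image_cone J G M) \<in> Obj D"
      by (simp add: image_cone_def G.fobj_Obj M.apex_in)
    show "leg (image_cone J G M) \<in> extensional (Obj J)"
      by (simp add: image_cone_def)
  next
    fix j assume "j \<in> Obj J"
    then show "leg (image_cone J G M) j \<in> hom D (apex (image_cone J G M)) (fobj (comp_func J G F) j)"
      using G.farr_in[OF M.leg_in] by (simp add: image_cone_def comp_func_def compose_def)
  next
    fix f i j assume f: "f \<in> hom J i j"
    then show "Comp D (farr (comp_func J G F) f) (leg (image_cone J G M) i) = leg (image_cone J G M) j"
      using M.diagram.source.hom_objs[OF f] M.leg_natural[OF f]
        G.farr_Comp[OF M.leg_in M.diagram.farr_in[OF f]]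
      by (simp add: image_cone_def comp_func_def compose_def hom_iff)
  qed
qed

text \<open>Nothing is asked on objects: the embedding of acsets below reaches only those slice
  objects that are identities on S_1.\<close>

definition fully_faithful where
  "fully_faithful C D G \<longleftrightarrow> cat_functor C D G \<and>
    (\<forall>x\<in>Obj C. \<forall>y\<in>Obj C. bij_betw (farr G) (hom C x y) (hom D (fobj G x) (fobj G y)))"

text \<open>Fullness lifts the mediating morphism of the image cones to \<open>C\<close>.
  Faithfulness allows equations between parallel arrows to be tested after applying
  \<open>G\<close>, which gives the factorization and its uniqueness.\<close>

lemma fully_faithful_reflects_limit:
  assumes G: "fully_faithful C D G"
    and M: "is_cone J C F M"
    and lim: "is_limit_cone J D (comp_func J G F) (image_cone J G M)"
  shows "is_limit_cone J C F M"
  unfolding is_limit_cone_def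
proof (intro conjI allI impI M)
  fix N assume N: "is_cone J C F N"
  interpret M: is_cone J C F M by fact
  interpret N: is_cone J C F N by fact
  interpret G: cat_functor C D G
    using G by (simp add: fully_faithful_def)
  have inj: "inj_on (farr G) (hom C x y)"
    and surj: "farr G ` hom C x y = hom D (fobj G x) (fobj G y)"
    if "x \<in> Obj C" "y \<in> Obj C" for x y
    using G that by (auto simp: fully_faithful_def bij_betw_def)
  let ?P = "\<lambda>v. v \<in> hom D (apex (image_cone J G N)) (apex (image_cone J G M)) \<and>
    (\<forall>j\<in>Obj J. Comp D (leg (image_cone J G M) j) v = leg (image_cone J G N) j)"
  have ex1: "\<exists>!v. ?P v"
    by (rule limit_coneD[OF lim is_cone_image_cone[OF N G.cat_functor_axioms]])
  \<comment> \<open>Both sides of a factorization equation lie in one hom-set, so injectivity of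
    \<open>G\<close> there cancels it.\<close>
  have transfer: "?P (farr G u) \<longleftrightarrow> (\<forall>j\<in>Obj J. Comp C (leg M j) u = leg N j)"
    if u: "u \<in> hom C (apex N) (apex M)" for u
  proof -
    have "Comp D (farr G (leg M j)) (farr G u) = farr G (leg N j) \<longleftrightarrow> Comp C (leg M j) u = leg N j"
      if j: "j \<in> Obj J" for j
      using G.farr_Comp[OF u M.leg_in[OF j]] M.diagram.target.Comp_in[OF u M.leg_in[OF j]] N.leg_in[OF j]
        inj[OF N.apex_in M.diagram.fobj_Obj[OF j]]
      by (metis inj_onD)
    then show ?thesis
      using G.farr_in[OF u] by (simp add: image_cone_def)
  qed
  obtain v where v: "?P v" using ex1 by blast
  then have "v \<in> farr G ` hom C (apex N) (apex M)"
    using surj[OF N.apex_in M.apex_in] by (simp add: image_cone_def)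
  then obtain u where u: "u \<in> hom C (apex N) (apex M)" and vu: "v = farr G u" by blast
  show "\<exists>!u. u \<in> hom C (apex N) (apex M) \<and> (\<forall>j\<in>Obj J. Comp C (leg M j) u = leg N j)"
  proof (rule ex1I[of _ u])
    show "u \<in> hom C (apex N) (apex M) \<and> (\<forall>j\<in>Obj J. Comp C (leg M j) u = leg N j)"
      using u v vu transfer by simp
  next
    fix w assume w: "w \<in> hom C (apex N) (apex M) \<and> (\<forall>j\<in>Obj J. Comp C (leg M j) w = leg N j)"
    then have "?P (farr G w)" using transfer by blast
    then have "farr G w = farr G u" using ex1 v vu by blast
    then show "w = u" using inj[OF N.apex_in M.apex_in] u w by (auto dest: inj_onD)
  qed
qed

section \<open>Isomorphisms of categories\<close>

lemma inverse_functors_apply: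
  assumes "inverse_functors C D \<Phi> \<Psi>"
  shows "x \<in> Obj C \<Longrightarrow> fobj \<Psi> (fobj \<Phi> x) = x" "f \<in> Arr C \<Longrightarrow> farr \<Psi> (farr \<Phi> f) = f"
    "y \<in> Obj D \<Longrightarrow> fobj \<Phi> (fobj \<Psi> y) = y" "g \<in> Arr D \<Longrightarrow> farr \<Phi> (farr \<Psi> g) = g"
proof -
  have "fobj (comp_func C \<Psi> \<Phi>) x = fobj (id_func C) x" "farr (comp_func C \<Psi> \<Phi>) f = farr (id_func C) f"
    "fobj (comp_func D \<Phi> \<Psi>) y = fobj (id_func D) y" "farr (comp_func D \<Phi> \<Psi>) g = farr (id_func D) g"
    using assms by (simp_all add: inverse_functors_def)
  then show "x \<in> Obj C \<Longrightarrow> fobj \<Psi> (fobj \<Phi> x) = x" "f \<in> Arr C \<Longrightarrow> farr \<Psi> (farr \<Phi> f) = f"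
    "y \<in> Obj D \<Longrightarrow> fobj \<Phi> (fobj \<Psi> y) = y" "g \<in> Arr D \<Longrightarrow> farr \<Phi> (farr \<Psi> g) = g"
    by (simp_all add: comp_func_def id_func_def compose_def)
qed

lemma inverse_functors_fully_faithful:
  assumes inv: "inverse_functors C D \<Phi> \<Psi>"
  shows "fully_faithful C D \<Phi>"
proof -
  interpret F: cat_functor C D \<Phi> using inv by (simp add: inverse_functors_def)
  interpret G: cat_functor D C \<Psi> using inv by (simp add: inverse_functors_def)
  have "bij_betw (farr \<Phi>) (hom C x y) (hom D (fobj \<Phi> x) (fobj \<Phi> y))"
    if xy: "x \<in> Obj C" "y \<in> Obj C" for x y
  proof (rule bij_betw_byWitness[where f' = "farr \<Psi>"])
    show "\<forall>f\<in>hom C x y. farr \<Psi> (farr \<Phi> f) = f"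
      using inverse_functors_apply(2)[OF inv] by (simp add: hom_iff)
    show "\<forall>g\<in>hom D (fobj \<Phi> x) (fobj \<Phi> y). farr \<Phi> (farr \<Psi> g) = g"
      using inverse_functors_apply(4)[OF inv] by (simp add: hom_iff)
    show "farr \<Phi> ` hom C x y \<subseteq> hom D (fobj \<Phi> x) (fobj \<Phi> y)"
      using F.farr_in by blast
    show "farr \<Psi> ` hom D (fobj \<Phi> x) (fobj \<Phi> y) \<subseteq> hom C x y"
      using G.farr_in inverse_functors_apply(1)[OF inv] xy by fastforce
  qed
  then show ?thesis
    using F.cat_functor_axioms by (simp add: fully_faithful_def)
qed

text \<open>\<open>\<Phi>\<close> sends the cone \<open>image_cone J \<Psi> M\<close> back to
  \<open>M\<close>, so reflection of limits along the fully faithful \<open>\<Phi>\<close> is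
  enough.\<close>

lemma limit_cone_inverse_image:
  assumes inv: "inverse_functors C D \<Phi> \<Psi>"
    and F: "cat_functor J C F"
    and lim: "is_limit_cone J D (comp_func J \<Phi> F) M"
  shows "is_limit_cone J C F (image_cone J \<Psi> M)"
proof -
  interpret F: cat_functor J C F by fact
  have M: "is_cone J D (comp_func J \<Phi> F) M" using lim by (simp add: is_limit_cone_def)
  interpret M: is_cone J D "comp_func J \<Phi> F" M by fact
  have "comp_func J \<Psi> (comp_func J \<Phi> F) = F"
    using F.fobj_in F.farr_in F.farr_ext inverse_functors_apply(1,2)[OF inv]
    by (intro func.equality)
      (auto simp: comp_func_def compose_def PiE_def extensional_def fun_eq_iff hom_iff Pi_iff)
  then have cone: "is_cone J C F (image_cone J \<Psi> M)"
    using is_cone_image_cone[OF M, of C \<Psi>] inv by (simp add: inverse_functors_def)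
  have "image_cone J \<Phi> (image_cone J \<Psi> M) = M"
    using M.apex_in M.leg_in M.leg_ext inverse_functors_apply(3,4)[OF inv]
    by (intro cone.equality)
      (auto simp: image_cone_def extensional_def fun_eq_iff hom_iff)
  then show ?thesis
    using fully_faithful_reflects_limit[OF inverse_functors_fully_faithful[OF inv] cone] lim by simp
qed

section \<open>Slice categories and enlarged diagrams\<close>

lemma adjoin_terminal_simps [simp]:
  "Obj (adjoin_terminal J) = insert None (Some ` Obj J)"
  "Arr (adjoin_terminal J) = Old ` Arr J \<union> To_new ` insert None (Some ` Obj J)"
  "Dom (adjoin_terminal J) (Old k) = Some (Dom J k)"
  "Dom (adjoin_terminal J) (To_new x) = x"
  "Cod (adjoin_terminal J) (Old k) = Some (Cod J k)"
  "Cod (adjoin_terminal J) (To_new x) = None"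
  "Ident (adjoin_terminal J) None = To_new None"
  "Ident (adjoin_terminal J) (Some j) = Old (Ident J j)"
  "Comp (adjoin_terminal J) (Old l) (Old k) = Old (Comp J l k)"
  "Comp (adjoin_terminal J) (To_new x) (Old k) = To_new (Some (Dom J k))"
  "Comp (adjoin_terminal J) g (To_new x) = To_new x"
  by (simp_all add: adjoin_terminal_def)

text \<open>The case \<open>New\<close> covers the arrows from old objects to the new one and also
  the identity of the new object, which is the instance \<open>x = None\<close>.\<close>

lemma hom_adjoin_terminal:
  assumes "f \<in> hom (adjoin_terminal J) x y"
  obtains (Old) k i j where "f = Old k" "x = Some i" "y = Some j" "k \<in> hom J i j"
  | (New) "f = To_new x" "y = None" "x \<in> Obj (adjoin_terminal J)"
  using assms by (auto simp: hom_iff)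

lemma category_adjoin_terminal:
  assumes "category J"
  shows "category (adjoin_terminal J)"
proof -
  interpret category J by fact
  show ?thesis
  proof
    fix f x y z g assume "f \<in> hom (adjoin_terminal J) x y" "g \<in> hom (adjoin_terminal J) y z"
    then show "Comp (adjoin_terminal J) g f \<in> hom (adjoin_terminal J) x z"
      by (elim hom_adjoin_terminal) (use hom_objs Comp_in in \<open>auto simp: hom_iff\<close>)
  next
    fix f w x y z g h assume "f \<in> hom (adjoin_terminal J) w x" "g \<in> hom (adjoin_terminal J) x y"
      "h \<in> hom (adjoin_terminal J) y z"
    then show "Comp (adjoin_terminal J) h (Comp (adjoin_terminal J) g f)
        = Comp (adjoin_terminal J) (Comp (adjoin_terminal J) h g) f"
      by (elim hom_adjoin_terminal) (use Comp_assoc Comp_in in \<open>auto simp: hom_iff\<close>)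
  next
    fix f x y assume f: "f \<in> hom (adjoin_terminal J) x y"
    then show "Comp (adjoin_terminal J) (Ident (adjoin_terminal J) y) f = f"
      by (elim hom_adjoin_terminal) (use Ident_left in \<open>auto simp: hom_iff\<close>)
    from f show "Comp (adjoin_terminal J) f (Ident (adjoin_terminal J) x) = f"
      by (elim hom_adjoin_terminal) (use Ident_right Ident_in in \<open>auto simp: hom_iff\<close>)
  qed (use Dom_in Cod_in Ident_in in \<open>auto simp: hom_iff\<close>)
qed

lemma finite_category_adjoin_terminal:
  "finite_category J \<Longrightarrow> finite_category (adjoin_terminal J)"
  by (simp add: finite_category_def category_adjoin_terminal)

lemma hom_slice_iff:
  "f \<in> hom (slice_cat D d) p q \<longleftrightarrow> source f = p \<and> target f = q \<and>
    p \<in> Arr D \<and> Cod D p = d \<and> q \<in> Arr D \<and> Cod D q = d \<and>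
    under f \<in> hom D (Dom D p) (Dom D q) \<and> Comp D q (under f) = p"
  by (cases f) (auto simp: slice_cat_def hom_def)

lemma slice_simps [simp]:
  "Obj (slice_cat D d) = {p \<in> Arr D. Cod D p = d}"
  "Dom (slice_cat D d) = source"
  "Cod (slice_cat D d) = target"
  "Ident (slice_cat D d) p = Arrow p (Ident D (Dom D p)) p"
  "Comp (slice_cat D d) g f = Arrow (source f) (Comp D (under g) (under f)) (target g)"
  by (simp_all add: slice_cat_def)

lemma category_slice:
  assumes "category D"
  shows "category (slice_cat D d)"
proof -
  interpret category D by fact
  have self: "p \<in> hom D (Dom D p) (Cod D p)" if "p \<in> Arr D" for p
    using that by (simp add: hom_iff)
  show ?thesis
  proof
    fix f x y z g assume fg: "f \<in> hom (slice_cat D d) x y" "g \<in> hom (slice_cat D d) y z"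
    then have "Comp D z (Comp D (under g) (under f)) = x"
      using Comp_assoc[of "under f" "Dom D x" "Dom D y" "under g" "Dom D z" z d] self[of z]
      by (simp add: hom_slice_iff)
    then show "Comp (slice_cat D d) g f \<in> hom (slice_cat D d) x z"
      using fg Comp_in by (auto simp: hom_slice_iff)
  next
    fix f w x y z g h assume "f \<in> hom (slice_cat D d) w x" "g \<in> hom (slice_cat D d) x y"
      "h \<in> hom (slice_cat D d) y z"
    then show "Comp (slice_cat D d) h (Comp (slice_cat D d) g f)
        = Comp (slice_cat D d) (Comp (slice_cat D d) h g) f"
      using Comp_assoc by (auto simp: hom_slice_iff)
  next
    fix f x y assume f: "f \<in> hom (slice_cat D d) x y"
    then show "Comp (slice_cat D d) (Ident (slice_cat D d) y) f = f"
      using Ident_left by (cases f) (auto simp: hom_slice_iff)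
    from f show "Comp (slice_cat D d) f (Ident (slice_cat D d) x) = f"
      using Ident_right by (cases f) (auto simp: hom_slice_iff)
  next
    fix x assume "x \<in> Obj (slice_cat D d)"
    then show "Ident (slice_cat D d) x \<in> hom (slice_cat D d) x x"
      using Ident_in Dom_in Ident_right[OF self] by (auto simp: hom_slice_iff)
  qed (auto simp: slice_cat_def)
qed

text \<open>The functor hypothesis puts the values of \<open>F\<close> in the slice, where the
  extensional maps of \<open>slice_forget\<close> take their intended values.\<close>

lemma enlarged_diagram_simps:
  assumes "cat_functor J (slice_cat D d) F"
  shows "fobj (enlarged_diagram D d J F) None = d"
    "j \<in> Obj J \<Longrightarrow> fobj (enlarged_diagram D d J F) (Some j) = Dom D (fobj F j)"
    "k \<in> Arr J \<Longrightarrow> farr (enlarged_diagram D d J F) (Old k) = under (farr F k)"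
    "farr (enlarged_diagram D d J F) (To_new None) = Ident D d"
    "j \<in> Obj J \<Longrightarrow> farr (enlarged_diagram D d J F) (To_new (Some j)) = fobj F j"
proof -
  interpret cat_functor J "slice_cat D d" F by fact
  have "farr F k \<in> Arr (slice_cat D d)" if "k \<in> Arr J" for k
    using farr_in[of k "Dom J k" "Cod J k"] that by (simp add: hom_iff)
  then show "fobj (enlarged_diagram D d J F) None = d"
    "j \<in> Obj J \<Longrightarrow> fobj (enlarged_diagram D d J F) (Some j) = Dom D (fobj F j)"
    "k \<in> Arr J \<Longrightarrow> farr (enlarged_diagram D d J F) (Old k) = under (farr F k)"
    "farr (enlarged_diagram D d J F) (To_new None) = Ident D d"
    "j \<in> Obj J \<Longrightarrow> farr (enlarged_diagram D d J F) (To_new (Some j)) = fobj F j"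
    using fobj_Obj[of j] by (auto simp: enlarged_diagram_def slice_forget_def)
qed

text \<open>On old arrows functoriality is inherited from \<open>F\<close>. The composite of an old
  arrow with an arrow to the new object is respected because a morphism of the slice is a commuting
  triangle over \<open>d\<close>.\<close>

lemma cat_functor_enlarged_diagram:
  assumes F: "cat_functor J (slice_cat D d) F" and D: "category D" and d: "d \<in> Obj D"
  shows "cat_functor (adjoin_terminal J) D (enlarged_diagram D d J F)"
proof -
  interpret D: category D by fact
  interpret F: cat_functor J "slice_cat D d" F by fact
  interpret A: category "adjoin_terminal J"
    using F.source.category_axioms by (rule category_adjoin_terminal)
  note simps = enlarged_diagram_simps[OF F]
  let ?E = "enlarged_diagram D d J F"
  have obj: "fobj F j \<in> hom D (Dom D (fobj F j)) d" if "j \<in> Obj J" for j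
    using F.fobj_Obj[OF that] by (simp add: hom_iff)
  have arr: "under (farr F k) \<in> hom D (Dom D (fobj F i)) (Dom D (fobj F j))"
    "Comp D (fobj F j) (under (farr F k)) = fobj F i" if "k \<in> hom J i j" for k i j
    using F.farr_in[OF that] by (simp_all add: hom_slice_iff)
  show ?thesis
  proof
    show "fobj ?E \<in> Obj (adjoin_terminal J) \<rightarrow>\<^sub>E Obj D"
    proof (rule PiE_I)
      fix x assume "x \<in> Obj (adjoin_terminal J)"
      then show "fobj ?E x \<in> Obj D"
        using d D.hom_objs[OF obj] by (auto simp: simps)
    qed (simp add: enlarged_diagram_def del: adjoin_terminal_simps)
    show "farr ?E \<in> extensional (Arr (adjoin_terminal J))"
      by (simp add: enlarged_diagram_def del: adjoin_terminal_simps)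
  next
    fix f x y assume f: "f \<in> hom (adjoin_terminal J) x y"
    from f show "farr ?E f \<in> hom D (fobj ?E x) (fobj ?E y)"
    proof (cases rule: hom_adjoin_terminal)
      case (Old k i j)
      then show ?thesis
        using arr(1) F.source.hom_objs[OF Old(4)] by (simp add: simps hom_iff)
    next
      case New
      then show ?thesis using obj D.Ident_in[OF d] by (auto simp: simps)
    qed
    fix z g assume g: "g \<in> hom (adjoin_terminal J) y z"
    from f show "farr ?E (Comp (adjoin_terminal J) g f) = Comp D (farr ?E g) (farr ?E f)"
    proof (cases rule: hom_adjoin_terminal)
      case f: (Old k i j)
      note ij = F.source.hom_objs[OF f(4)]
      from g show ?thesis
      proof (cases rule: hom_adjoin_terminal)
        case g: (Old l i' j')
        then have l: "l \<in> hom J j j'" using f by simp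
        show ?thesis
          using f g l F.farr_Comp[OF f(4) l] F.source.Comp_in[OF f(4) l] by (simp add: simps hom_iff)
      next
        case New
        then show ?thesis using f ij arr(2)[OF f(4)] by (simp add: simps hom_iff)
      qed
    next
      case f: New
      from g show ?thesis
      proof (cases rule: hom_adjoin_terminal)
        case New
        then show ?thesis
          using f D.Ident_left[OF obj] D.Ident_left[OF D.Ident_in[OF d]] by (auto simp: simps)
      qed (use f in simp)
    qed
  next
    fix x assume "x \<in> Obj (adjoin_terminal J)"
    then show "farr ?E (Ident (adjoin_terminal J) x) = Ident D (fobj ?E x)"
      using F.source.Ident_in F.farr_Ident by (auto simp: simps hom_iff)
  qed
qed

section \<open>Cones in the slice and cones over the enlarged diagram\<close>

definition slice_lift :: "('j, 'k) cat \<Rightarrow> ('j, 'k, 'a, ('a, 'a) arrow) func \<Rightarrow>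
    ('j option, 'o, 'a) cone \<Rightarrow> ('j, 'a, ('a, 'a) arrow) cone" where
  "slice_lift J F \<Lambda> = \<lparr>apex = leg \<Lambda> None,
    leg = (\<lambda>j\<in>Obj J. Arrow (leg \<Lambda> None) (leg \<Lambda> (Some j)) (fobj F j))\<rparr>"

text \<open>Naturality of \<open>\<Lambda>\<close> along the arrow from \<open>j\<close> to the new
  object says that the leg at \<open>j\<close> is a morphism over \<open>d\<close>. The lift is
  unique because an arrow of the slice is determined by its underlying morphism and its endpoints,
  and the lifting condition together with the diagram fixes all three.\<close>

lemma slice_lift_lifts_cone:
  assumes F: "cat_functor J (slice_cat D d) F"
    and \<Lambda>: "is_cone (adjoin_terminal J) D (enlarged_diagram D d J F) \<Lambda>"
  shows "is_cone J (slice_cat D d) F (slice_lift J F \<Lambda>)"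
    and "lifts_cone D d J (slice_lift J F \<Lambda>) \<Lambda>"
    and "is_cone J (slice_cat D d) F N \<Longrightarrow> lifts_cone D d J N \<Lambda> \<Longrightarrow> N = slice_lift J F \<Lambda>"
proof -
  interpret F: cat_functor J "slice_cat D d" F by fact
  interpret L: is_cone "adjoin_terminal J" D "enlarged_diagram D d J F" \<Lambda> by fact
  note simps = enlarged_diagram_simps[OF F]
  let ?M = "slice_lift J F \<Lambda>"
  have top: "leg \<Lambda> None \<in> hom D (apex \<Lambda>) d"
    using L.leg_in[of None] by (simp add: simps)
  have leg: "leg ?M j \<in> hom (slice_cat D d) (apex ?M) (fobj F j)" if j: "j \<in> Obj J" for j
  proof -
    have "To_new (Some j) \<in> hom (adjoin_terminal J) (Some j) None"
      using j by (simp add: hom_iff)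
    from L.leg_natural[OF this] have "Comp D (fobj F j) (leg \<Lambda> (Some j)) = leg \<Lambda> None"
      using j by (simp add: simps)
    then show ?thesis
      using j top L.leg_in[of "Some j"] F.fobj_Obj[OF j]
      by (simp add: slice_lift_def hom_slice_iff simps) (simp add: hom_iff)
  qed
  show cone: "is_cone J (slice_cat D d) F ?M"
  proof
    show "apex ?M \<in> Obj (slice_cat D d)"
      using top by (simp add: slice_lift_def hom_iff)
    show "leg ?M \<in> extensional (Obj J)"
      by (simp add: slice_lift_def)
    show "\<And>j. j \<in> Obj J \<Longrightarrow> leg ?M j \<in> hom (slice_cat D d) (apex ?M) (fobj F j)"
      by (rule leg)
  next
    fix f i j assume f: "f \<in> hom J i j"
    then have "Old f \<in> hom (adjoin_terminal J) (Some i) (Some j)"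
      by (simp add: hom_iff)
    then show "Comp (slice_cat D d) (farr F f) (leg ?M i) = leg ?M j"
      using L.leg_natural[of "Old f"] F.source.hom_objs[OF f] F.farr_in[OF f] f
      by (simp add: slice_lift_def hom_slice_iff simps hom_iff)
  qed
  have Arr: "leg N j \<in> Arr (slice_cat D d)" if "is_cone J (slice_cat D d) F N" "j \<in> Obj J" for N j
    using is_cone.leg_in[OF that] by (simp add: hom_iff)
  show "lifts_cone D d J ?M \<Lambda>"
    using top Arr[OF cone] by (simp add: lifts_cone_def slice_forget_def hom_iff slice_lift_def)
  assume N: "is_cone J (slice_cat D d) F N" and lift: "lifts_cone D d J N \<Lambda>"
  interpret N: is_cone J "slice_cat D d" F N by fact
  show "N = ?M"
  proof (rule cone.equality)
    show apex: "apex N = apex ?M"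
      using lift by (simp add: lifts_cone_def slice_lift_def)
    show "leg N = leg ?M"
    proof (rule extensionalityI[OF N.leg_ext])
      show "leg ?M \<in> extensional (Obj J)" by (simp add: slice_lift_def)
      fix j assume j: "j \<in> Obj J"
      then have "farr (slice_forget D d) (leg N j) = leg \<Lambda> (Some j)"
        using lift unfolding lifts_cone_def by blast
      then have "under (leg N j) = leg \<Lambda> (Some j)"
        using Arr[OF N j] by (simp add: slice_forget_def)
      then show "leg N j = leg ?M j"
        using N.leg_in[OF j] apex j by (cases "leg N j") (simp add: hom_slice_iff slice_lift_def)
    qed
  qed simp
qed

text \<open>Cones in the slice correspond to cones over the enlarged diagram with the same mediating
  morphisms, so the universal property passes from one to the other.\<close>

lemma is_limit_cone_slice_lift:
  assumes F: "cat_functor J (slice_cat D d) F"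
    and lim: "is_limit_cone (adjoin_terminal J) D (enlarged_diagram D d J F) \<Lambda>"
  shows "is_limit_cone J (slice_cat D d) F (slice_lift J F \<Lambda>)"
  unfolding is_limit_cone_def
proof (intro conjI allI impI)
  have \<Lambda>: "is_cone (adjoin_terminal J) D (enlarged_diagram D d J F) \<Lambda>"
    using lim by (simp add: is_limit_cone_def)
  then show "is_cone J (slice_cat D d) F (slice_lift J F \<Lambda>)"
    by (rule slice_lift_lifts_cone(1)[OF F])
  fix N assume N: "is_cone J (slice_cat D d) F N"
  interpret F: cat_functor J "slice_cat D d" F by fact
  interpret L: is_cone "adjoin_terminal J" D "enlarged_diagram D d J F" \<Lambda> by fact
  interpret N: is_cone J "slice_cat D d" F N by fact
  note simps = enlarged_diagram_simps[OF F]
  let ?M = "slice_lift J F \<Lambda>"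
  \<comment> \<open>This inverts \<open>slice_lift\<close>: the structure morphism of the apex
    becomes the leg at the new object.\<close>
  define N' where "N' = \<lparr>apex = Dom D (apex N),
    leg = (\<lambda>x\<in>Obj (adjoin_terminal J). case x of None \<Rightarrow> apex N | Some j \<Rightarrow> under (leg N j))\<rparr>"
  have N'_simps: "apex N' = Dom D (apex N)" "leg N' None = apex N"
    "\<And>j. j \<in> Obj J \<Longrightarrow> leg N' (Some j) = under (leg N j)"
    by (simp_all add: N'_def)
  have top: "apex N \<in> hom D (Dom D (apex N)) d"
    using N.apex_in by (simp add: hom_iff)
  have leg: "source (leg N j) = apex N" "target (leg N j) = fobj F j"
    "under (leg N j) \<in> hom D (Dom D (apex N)) (Dom D (fobj F j))"
    "Comp D (fobj F j) (under (leg N j)) = apex N" if "j \<in> Obj J" for j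
    using N.leg_in[OF that] by (simp_all add: hom_slice_iff)
  have N': "is_cone (adjoin_terminal J) D (enlarged_diagram D d J F) N'"
  proof
    show "apex N' \<in> Obj D"
      using L.diagram.target.hom_objs(1)[OF top] by (simp add: N'_simps)
    show "leg N' \<in> extensional (Obj (adjoin_terminal J))"
      by (simp add: N'_def del: adjoin_terminal_simps)
  next
    fix x assume "x \<in> Obj (adjoin_terminal J)"
    then show "leg N' x \<in> hom D (apex N') (fobj (enlarged_diagram D d J F) x)"
      using top leg by (auto simp: simps N'_simps)
  next
    fix f x y assume "f \<in> hom (adjoin_terminal J) x y"
    then show "Comp D (farr (enlarged_diagram D d J F) f) (leg N' x) = leg N' y"
    proof (cases rule: hom_adjoin_terminal)
      case (Old k i j)
      have "under (Comp (slice_cat D d) (farr F k) (leg N i)) = under (leg N j)"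
        using N.leg_natural[OF Old(4)] by simp
      then show ?thesis
        using Old F.source.hom_objs[OF Old(4)] by (simp add: simps N'_simps hom_iff)
    next
      case New
      then show ?thesis
        using leg L.diagram.target.Ident_left[OF top] by (auto simp: simps N'_simps)
    qed
  qed
  \<comment> \<open>The equation at \<open>None\<close> is the condition that \<open>u\<close> is a
    morphism over \<open>d\<close>; the equations at \<open>Some j\<close> are the factorizations in
    the slice.\<close>
  have iff: "u \<in> hom D (apex N') (apex \<Lambda>) \<and>
      (\<forall>x\<in>Obj (adjoin_terminal J). Comp D (leg \<Lambda> x) u = leg N' x) \<longleftrightarrow>
    Arrow (apex N) u (apex ?M) \<in> hom (slice_cat D d) (apex N) (apex ?M) \<and>
      (\<forall>j\<in>Obj J. Comp (slice_cat D d) (leg ?M j) (Arrow (apex N) u (apex ?M)) = leg N j)" for u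
  proof -
    have "Arrow (apex N) v (fobj F j) = leg N j \<longleftrightarrow> v = under (leg N j)" if "j \<in> Obj J" for v j
      using leg(1,2)[OF that] by (cases "leg N j") auto
    moreover have "leg \<Lambda> None \<in> Arr D" "Dom D (leg \<Lambda> None) = apex \<Lambda>" "Cod D (leg \<Lambda> None) = d"
      "apex N \<in> Arr D" "Cod D (apex N) = d"
      using top L.leg_in[of None] by (simp_all add: simps hom_iff)
    ultimately show ?thesis
      by (auto simp: hom_slice_iff slice_lift_def N'_simps)
  qed
  obtain u where u: "u \<in> hom D (apex N') (apex \<Lambda>) \<and>
      (\<forall>x\<in>Obj (adjoin_terminal J). Comp D (leg \<Lambda> x) u = leg N' x)"
    and uniq: "\<And>v. v \<in> hom D (apex N') (apex \<Lambda>) \<and>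
      (\<forall>x\<in>Obj (adjoin_terminal J). Comp D (leg \<Lambda> x) v = leg N' x) \<Longrightarrow> v = u"
    using limit_coneD[OF lim N'] by blast
  show "\<exists>!u. u \<in> hom (slice_cat D d) (apex N) (apex ?M) \<and>
      (\<forall>j\<in>Obj J. Comp (slice_cat D d) (leg ?M j) u = leg N j)"
  proof (rule ex1I[of _ "Arrow (apex N) u (apex ?M)"])
    show "Arrow (apex N) u (apex ?M) \<in> hom (slice_cat D d) (apex N) (apex ?M) \<and>
      (\<forall>j\<in>Obj J. Comp (slice_cat D d) (leg ?M j) (Arrow (apex N) u (apex ?M)) = leg N j)"
      using u iff by blast
  next
    fix w assume w: "w \<in> hom (slice_cat D d) (apex N) (apex ?M) \<and>
      (\<forall>j\<in>Obj J. Comp (slice_cat D d) (leg ?M j) w = leg N j)"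
    then have w_eq: "w = Arrow (apex N) (under w) (apex ?M)"
      by (cases w) (simp add: hom_slice_iff)
    with w have "under w = u" using iff uniq by metis
    then show "w = Arrow (apex N) u (apex ?M)" using w_eq by simp
  qed
qed

section \<open>Pointwise limits in functor categories\<close>

lemma hom_functor_cat_iff:
  "f \<in> hom (functor_cat C D) F G \<longleftrightarrow> source f = F \<and> target f = G \<and> nat_transf C D F G (under f)"
  by (cases f) (auto simp: functor_cat_def hom_def)

lemma functor_cat_simps [simp]:
  "F \<in> Obj (functor_cat C D) \<longleftrightarrow> cat_functor C D F"
  "Dom (functor_cat C D) = source"
  "Cod (functor_cat C D) = target"
  "Ident (functor_cat C D) F = Arrow F (\<lambda>x\<in>Obj C. Ident D (fobj F x)) F"
  "Comp (functor_cat C D) \<beta> \<alpha> =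
    Arrow (source \<alpha>) (\<lambda>x\<in>Obj C. Comp D (under \<beta> x) (under \<alpha> x)) (target \<beta>)"
  by (simp_all add: functor_cat_def)

lemma nat_transf_Ident:
  assumes "cat_functor C D F"
  shows "nat_transf C D F F (\<lambda>x\<in>Obj C. Ident D (fobj F x))"
proof -
  interpret cat_functor C D F by fact
  show ?thesis
  proof
    fix f x y assume f: "f \<in> hom C x y"
    then show "Comp D ((\<lambda>x\<in>Obj C. Ident D (fobj F x)) y) (farr F f)
        = Comp D (farr F f) ((\<lambda>x\<in>Obj C. Ident D (fobj F x)) x)"
      using source.hom_objs[OF f] target.Ident_left target.Ident_right farr_in[OF f] by simp
  qed (use fobj_Obj target.Ident_in in simp_all)
qed

lemma nat_transf_Comp:
  assumes \<alpha>: "nat_transf C D F G \<alpha>" and \<beta>: "nat_transf C D G H \<beta>"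
  shows "nat_transf C D F H (\<lambda>x\<in>Obj C. Comp D (\<beta> x) (\<alpha> x))"
proof -
  interpret a: nat_transf C D F G \<alpha> by fact
  interpret b: nat_transf C D G H \<beta> by fact
  show ?thesis
  proof
    fix x assume "x \<in> Obj C"
    then show "(\<lambda>x\<in>Obj C. Comp D (\<beta> x) (\<alpha> x)) x \<in> hom D (fobj F x) (fobj H x)"
      using a.F.target.Comp_in[OF a.component_in b.component_in] by simp
  next
    fix f x y assume f: "f \<in> hom C x y"
    note xy = a.F.source.hom_objs[OF f]
    note a = a.component_in[OF xy(1)] a.component_in[OF xy(2)]
    note b = b.component_in[OF xy(1)] b.component_in[OF xy(2)]
    note assoc = a.F.target.Comp_assoc
    have "Comp D (Comp D (\<beta> y) (\<alpha> y)) (farr F f) = Comp D (\<beta> y) (Comp D (\<alpha> y) (farr F f))"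
      using assoc[OF a.F.farr_in[OF f] a(2) b(2)] by simp
    also have "\<dots> = Comp D (\<beta> y) (Comp D (farr G f) (\<alpha> x))"
      using a.naturality[OF f] by simp
    also have "\<dots> = Comp D (Comp D (\<beta> y) (farr G f)) (\<alpha> x)"
      using assoc[OF a(1) a.G.farr_in[OF f] b(2)] by simp
    also have "\<dots> = Comp D (Comp D (farr H f) (\<beta> x)) (\<alpha> x)"
      using b.naturality[OF f] by simp
    also have "\<dots> = Comp D (farr H f) (Comp D (\<beta> x) (\<alpha> x))"
      using assoc[OF a(1) b(1) b.G.farr_in[OF f]] by simp
    finally show "Comp D ((\<lambda>x\<in>Obj C. Comp D (\<beta> x) (\<alpha> x)) y) (farr F f)
        = Comp D (farr H f) ((\<lambda>x\<in>Obj C. Comp D (\<beta> x) (\<alpha> x)) x)"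
      using xy by simp
  qed simp
qed

text \<open>The laws of \<open>D\<close> are taken from the functor or natural transformation at
  hand, each of which carries the axioms of both categories.\<close>

lemma category_functor_cat: "category (functor_cat C D)"
proof
  fix f x y z g assume "f \<in> hom (functor_cat C D) x y" "g \<in> hom (functor_cat C D) y z"
  then show "Comp (functor_cat C D) g f \<in> hom (functor_cat C D) x z"
    using nat_transf_Comp by (auto simp: hom_functor_cat_iff)
next
  fix f w x y z g h assume "f \<in> hom (functor_cat C D) w x" "g \<in> hom (functor_cat C D) x y"
    "h \<in> hom (functor_cat C D) y z"
  then have f: "nat_transf C D w x (under f)" and g: "nat_transf C D x y (under g)"
    and h: "nat_transf C D y z (under h)"
    by (auto simp: hom_functor_cat_iff)
  interpret f: nat_transf C D w x "under f" by fact
  show "Comp (functor_cat C D) h (Comp (functor_cat C D) g f)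
      = Comp (functor_cat C D) (Comp (functor_cat C D) h g) f"
    using f.F.target.Comp_assoc[OF nat_transf.component_in[OF f] nat_transf.component_in[OF g]
        nat_transf.component_in[OF h]]
    by (auto intro!: restrict_ext)
next
  fix f x y assume f: "f \<in> hom (functor_cat C D) x y"
  then interpret f: nat_transf C D x y "under f" by (simp add: hom_functor_cat_iff)
  have "(\<lambda>v\<in>Obj C. Comp D (Ident D (fobj y v)) (under f v)) = under f"
    "(\<lambda>v\<in>Obj C. Comp D (under f v) (Ident D (fobj x v))) = under f"
    using f.component_in f.component_ext
    by (auto intro!: extensionalityI[of _ "Obj C"] f.F.target.Ident_left f.F.target.Ident_right)
  then show "Comp (functor_cat C D) (Ident (functor_cat C D) y) f = f"
    "Comp (functor_cat C D) f (Ident (functor_cat C D) x) = f"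
    using f by (cases f; auto simp: hom_functor_cat_iff cong: restrict_cong)+
next
  fix F assume "F \<in> Obj (functor_cat C D)"
  then show "Ident (functor_cat C D) F \<in> hom (functor_cat C D) F F"
    using nat_transf_Ident by (auto simp: hom_functor_cat_iff)
qed (auto simp: functor_cat_def nat_transf_def)

definition eval_diagram where
  "eval_diagram J F x = \<lparr>fobj = (\<lambda>j\<in>Obj J. fobj (fobj F j) x), farr = (\<lambda>k\<in>Arr J. under (farr F k) x)\<rparr>"

lemma cat_functor_eval_diagram:
  assumes F: "cat_functor J (functor_cat C D) F" and D: "category D" and x: "x \<in> Obj C"
  shows "cat_functor J D (eval_diagram J F x)"
proof -
  interpret D: category D by fact
  interpret F: cat_functor J "functor_cat C D" F by fact
  have obj: "fobj (fobj F j) x \<in> Obj D" if "j \<in> Obj J" for j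
    using cat_functor.fobj_Obj[OF _ x] F.fobj_Obj[OF that] by simp
  show ?thesis
  proof
    fix k i j assume k: "k \<in> hom J i j"
    then show "farr (eval_diagram J F x) k \<in> hom D (fobj (eval_diagram J F x) i) (fobj (eval_diagram J F x) j)"
      using F.source.hom_objs[OF k] F.farr_in[OF k] k
        nat_transf.component_in[OF _ x, of D "fobj F i" "fobj F j" "under (farr F k)"]
      by (simp add: eval_diagram_def hom_functor_cat_iff) (simp add: hom_iff)
  next
    fix j assume "j \<in> Obj J"
    then show "farr (eval_diagram J F x) (Ident J j) = Ident D (fobj (eval_diagram J F x) j)"
      using F.source.Ident_in[of j] F.farr_Ident x by (simp add: eval_diagram_def hom_iff)
  next
    fix k l h i j assume k: "k \<in> hom J h i" and l: "l \<in> hom J i j"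
    then show "farr (eval_diagram J F x) (Comp J l k)
        = Comp D (farr (eval_diagram J F x) l) (farr (eval_diagram J F x) k)"
      using F.source.Comp_in[OF k l] F.farr_Comp[OF k l] x by (simp add: eval_diagram_def hom_iff)
  qed (auto simp: eval_diagram_def obj)
qed

text \<open>Both arrows mediate from the same cone, whose legs are the composites of the limit legs
  with \<open>u\<close>. In \<open>pointwise_limit\<close> this proves the functor laws and the
  naturality of the mediating transformation.\<close>

lemma limit_cone_jointly_monic:
  assumes lim: "is_limit_cone J D F M"
    and u: "u \<in> hom D a (apex M)" and v: "v \<in> hom D a (apex M)"
    and eq: "\<And>j. j \<in> Obj J \<Longrightarrow> Comp D (leg M j) u = Comp D (leg M j) v"
  shows "u = v"
proof -
  interpret M: is_cone J D F M using lim by (simp add: is_limit_cone_def)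
  let ?N = "\<lparr>apex = a, leg = (\<lambda>j\<in>Obj J. Comp D (leg M j) u)\<rparr>"
  have "is_cone J D F ?N"
  proof
    fix f i j assume f: "f \<in> hom J i j"
    note ij = M.diagram.source.hom_objs[OF f]
    show "Comp D (farr F f) (leg ?N i) = leg ?N j"
      using M.diagram.target.Comp_assoc[OF u M.leg_in[OF ij(1)] M.diagram.farr_in[OF f]]
        M.leg_natural[OF f] ij by simp
  qed (use M.diagram.target.hom_objs[OF u] M.diagram.target.Comp_in[OF u M.leg_in] in auto)
  from limit_coneD[OF lim this]
  have ex1: "\<exists>!w. w \<in> hom D a (apex M) \<and> (\<forall>j\<in>Obj J. Comp D (leg M j) w = Comp D (leg M j) u)"
    by simp
  moreover have "\<forall>j\<in>Obj J. Comp D (leg M j) v = Comp D (leg M j) u"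
    using eq by simp
  ultimately show ?thesis
    using u v by blast
qed

text \<open>The limit cones \<open>M x\<close> are supplied from outside, and the limit functor
  takes exactly their apexes as values; this equality, rather than an isomorphism, later makes the
  limit an acset. The action on an arrow \<open>f\<close> is induced by the legs composed with the
  maps \<open>farr (fobj F j) f\<close>.\<close>

lemma pointwise_limit:
  assumes F: "cat_functor J (functor_cat C D) F"
    and C: "category C" and D: "category D"
    and lim: "\<And>x. x \<in> Obj C \<Longrightarrow> is_limit_cone J D (eval_diagram J F x) (M x)"
  obtains L where "\<And>x. x \<in> Obj C \<Longrightarrow> fobj L x = apex (M x)"
    and "is_limit_cone J (functor_cat C D) F
      \<lparr>apex = L, leg = (\<lambda>j\<in>Obj J. Arrow L (\<lambda>x\<in>Obj C. leg (M x) j) (fobj F j))\<rparr>"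
proof -
  interpret C: category C by fact
  interpret D: category D by fact
  interpret F: cat_functor J "functor_cat C D" F by fact
  have cone: "is_cone J D (eval_diagram J F x) (M x)" if "x \<in> Obj C" for x
    using lim[OF that] by (simp add: is_limit_cone_def)
  have Fj: "cat_functor C D (fobj F j)" if "j \<in> Obj J" for j
    using F.fobj_Obj[OF that] by simp
  have Fk: "nat_transf C D (fobj F i) (fobj F j) (under (farr F k))" if "k \<in> hom J i j" for k i j
    using F.farr_in[OF that] by (simp add: hom_functor_cat_iff)
  have leg: "leg (M x) j \<in> hom D (apex (M x)) (fobj (fobj F j) x)" if "x \<in> Obj C" "j \<in> Obj J" for x j
    using is_cone.leg_in[OF cone[OF that(1)] that(2)] that by (simp add: eval_diagram_def)
  have leg_natural: "Comp D (under (farr F k) x) (leg (M x) i) = leg (M x) j"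
    if "x \<in> Obj C" "k \<in> hom J i j" for x k i j
    using is_cone.leg_natural[OF cone[OF that(1)] that(2)] that by (simp add: eval_diagram_def hom_iff)
  have coneI: "is_cone J D (eval_diagram J F x) \<lparr>apex = a, leg = restrict l (Obj J)\<rparr>"
    if x: "x \<in> Obj C" and a: "a \<in> Obj D"
      and l: "\<And>j. j \<in> Obj J \<Longrightarrow> l j \<in> hom D a (fobj (fobj F j) x)"
      and nat: "\<And>k i j. k \<in> hom J i j \<Longrightarrow> Comp D (under (farr F k) x) (l i) = l j" for x a l
  proof -
    interpret E: cat_functor J D "eval_diagram J F x"
      by (rule cat_functor_eval_diagram[OF F D x])
    show ?thesis
    proof
      fix k i j assume k: "k \<in> hom J i j"
      then show "Comp D (farr (eval_diagram J F x) k) (leg \<lparr>apex = a, leg = restrict l (Obj J)\<rparr> i)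
          = leg \<lparr>apex = a, leg = restrict l (Obj J)\<rparr> j"
        using nat[OF k] F.source.hom_objs[OF k] by (simp add: eval_diagram_def hom_iff)
    qed (use a l in \<open>auto simp: eval_diagram_def\<close>)
  qed
  \<comment> \<open>The endpoints are written as \<open>Dom C f\<close> and \<open>Cod C f\<close>
    so that a description can define the action on an arrow without naming objects.\<close>
  let ?P = "\<lambda>f u. u \<in> hom D (apex (M (Dom C f))) (apex (M (Cod C f))) \<and>
    (\<forall>j\<in>Obj J. Comp D (leg (M (Cod C f)) j) u = Comp D (farr (fobj F j) f) (leg (M (Dom C f)) j))"
  define L where "L = \<lparr>fobj = (\<lambda>x\<in>Obj C. apex (M x)), farr = (\<lambda>f\<in>Arr C. THE u. ?P f u)\<rparr>"
  have P: "\<exists>!u. ?P f u" if f: "f \<in> hom C x y" for f x y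
  proof -
    note xy = C.hom_objs[OF f]
    let ?l = "\<lambda>j. Comp D (farr (fobj F j) f) (leg (M x) j)"
    have l: "?l j \<in> hom D (apex (M x)) (fobj (fobj F j) y)" if "j \<in> Obj J" for j
      using D.Comp_in[OF leg[OF xy(1) that] cat_functor.farr_in[OF Fj[OF that] f]] .
    \<comment> \<open>The composites form a cone because the transformation assigned to
      \<open>k\<close> is natural along \<open>f\<close>.\<close>
    have "Comp D (under (farr F k) y) (?l i) = ?l j" if k: "k \<in> hom J i j" for k i j
    proof -
      note ij = F.source.hom_objs[OF k]
      note Ff = cat_functor.farr_in[OF Fj f]
      have "Comp D (under (farr F k) y) (?l i)
          = Comp D (Comp D (under (farr F k) y) (farr (fobj F i) f)) (leg (M x) i)"
        using D.Comp_assoc[OF leg[OF xy(1) ij(1)] Ff[OF ij(1)] nat_transf.component_in[OF Fk[OF k] xy(2)]] .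
      also have "\<dots> = Comp D (Comp D (farr (fobj F j) f) (under (farr F k) x)) (leg (M x) i)"
        using nat_transf.naturality[OF Fk[OF k] f] by simp
      also have "\<dots> = ?l j"
        using D.Comp_assoc[OF leg[OF xy(1) ij(1)] nat_transf.component_in[OF Fk[OF k] xy(1)] Ff[OF ij(2)]]
          leg_natural[OF xy(1) k] by simp
      finally show ?thesis .
    qed
    from limit_coneD[OF lim[OF xy(2)] coneI[OF xy(2) _ l this]] is_cone.apex_in[OF cone[OF xy(1)]]
    show ?thesis using f by (simp add: hom_iff cong: conj_cong)
  qed
  have Lx: "fobj L x = apex (M x)" if "x \<in> Obj C" for x
    using that by (simp add: L_def)
  have Lf: "farr L f \<in> hom D (apex (M x)) (apex (M y))"
    "\<And>j. j \<in> Obj J \<Longrightarrow> Comp D (leg (M y) j) (farr L f) = Comp D (farr (fobj F j) f) (leg (M x) j)"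
    if f: "f \<in> hom C x y" for f x y
    using theI'[OF P[OF f]] f by (simp_all add: L_def hom_iff)
  interpret L: cat_functor C D L
  proof
    show "fobj L \<in> Obj C \<rightarrow>\<^sub>E Obj D"
      using is_cone.apex_in[OF cone] by (simp add: L_def)
    show "farr L \<in> extensional (Arr C)"
      by (simp add: L_def)
  next
    fix f x y assume f: "f \<in> hom C x y"
    then show "farr L f \<in> hom D (fobj L x) (fobj L y)"
      using Lf(1)[OF f] Lx C.hom_objs[OF f] by simp
  next
    fix x assume x: "x \<in> Obj C"
    have "farr L (Ident C x) = Ident D (apex (M x))"
    proof (rule limit_cone_jointly_monic[OF lim[OF x] Lf(1)[OF C.Ident_in[OF x]]])
      show "Ident D (apex (M x)) \<in> hom D (apex (M x)) (apex (M x))"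
        using D.Ident_in is_cone.apex_in[OF cone[OF x]] .
      fix j assume j: "j \<in> Obj J"
      show "Comp D (leg (M x) j) (farr L (Ident C x)) = Comp D (leg (M x) j) (Ident D (apex (M x)))"
        using Lf(2)[OF C.Ident_in[OF x] j] cat_functor.farr_Ident[OF Fj[OF j] x]
          D.Ident_left[OF leg[OF x j]] D.Ident_right[OF leg[OF x j]] by simp
    qed
    then show "farr L (Ident C x) = Ident D (fobj L x)" using Lx[OF x] by simp
  next
    fix f g x y z assume f: "f \<in> hom C x y" and g: "g \<in> hom C y z"
    note gf = C.Comp_in[OF f g] and x = C.hom_objs(1)[OF f] and y = C.hom_objs(1)[OF g]
      and z = C.hom_objs(2)[OF g]
    show "farr L (Comp C g f) = Comp D (farr L g) (farr L f)"
    proof (rule limit_cone_jointly_monic[OF lim[OF z] Lf(1)[OF gf] D.Comp_in[OF Lf(1)[OF f] Lf(1)[OF g]]])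
      fix j assume j: "j \<in> Obj J"
      note Fj_in = cat_functor.farr_in[OF Fj[OF j]]
      have "Comp D (leg (M z) j) (farr L (Comp C g f))
          = Comp D (Comp D (farr (fobj F j) g) (farr (fobj F j) f)) (leg (M x) j)"
        using Lf(2)[OF gf j] cat_functor.farr_Comp[OF Fj[OF j] f g] by simp
      also have "\<dots> = Comp D (farr (fobj F j) g) (Comp D (farr (fobj F j) f) (leg (M x) j))"
        using D.Comp_assoc[OF leg[OF x j] Fj_in[OF f] Fj_in[OF g]] by simp
      also have "\<dots> = Comp D (farr (fobj F j) g) (Comp D (leg (M y) j) (farr L f))"
        using Lf(2)[OF f j] by simp
      also have "\<dots> = Comp D (Comp D (leg (M z) j) (farr L g)) (farr L f)"
        using D.Comp_assoc[OF Lf(1)[OF f] leg[OF y j] Fj_in[OF g]] Lf(2)[OF g j] by simp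
      also have "\<dots> = Comp D (leg (M z) j) (Comp D (farr L g) (farr L f))"
        using D.Comp_assoc[OF Lf(1)[OF f] Lf(1)[OF g] leg[OF z j]] by simp
      finally show "Comp D (leg (M z) j) (farr L (Comp C g f))
          = Comp D (leg (M z) j) (Comp D (farr L g) (farr L f))" .
    qed
  qed
  let ?M = "\<lparr>apex = L, leg = (\<lambda>j\<in>Obj J. Arrow L (\<lambda>x\<in>Obj C. leg (M x) j) (fobj F j))\<rparr>"
  have coneM: "is_cone J (functor_cat C D) F ?M"
  proof
    show "apex ?M \<in> Obj (functor_cat C D)" using L.cat_functor_axioms by simp
    show "leg ?M \<in> extensional (Obj J)" by simp
  next
    fix j assume j: "j \<in> Obj J"
    interpret Fj: cat_functor C D "fobj F j" using Fj[OF j] .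
    have "nat_transf C D L (fobj F j) (\<lambda>x\<in>Obj C. leg (M x) j)"
      by unfold_locales (use leg Lx Lf(2) j C.hom_objs in auto)
    then show "leg ?M j \<in> hom (functor_cat C D) (apex ?M) (fobj F j)"
      using j by (simp add: hom_functor_cat_iff)
  next
    fix k i j assume k: "k \<in> hom J i j"
    show "Comp (functor_cat C D) (farr F k) (leg ?M i) = leg ?M j"
      using F.source.hom_objs[OF k] leg_natural[OF _ k] F.farr_in[OF k]
      by (auto simp: hom_functor_cat_iff intro!: restrict_ext)
  qed
  have "is_limit_cone J (functor_cat C D) F ?M"
    unfolding is_limit_cone_def
  proof (intro conjI allI impI coneM)
    fix N assume N: "is_cone J (functor_cat C D) F N"
    interpret N: is_cone J "functor_cat C D" F N by fact
    interpret aN: cat_functor C D "apex N" using N.apex_in by simp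
    have N_leg: "nat_transf C D (apex N) (fobj F j) (under (leg N j))"
      "source (leg N j) = apex N" "target (leg N j) = fobj F j" if "j \<in> Obj J" for j
      using N.leg_in[OF that] by (simp_all add: hom_functor_cat_iff)
    let ?Q = "\<lambda>x u. u \<in> hom D (fobj (apex N) x) (apex (M x)) \<and>
      (\<forall>j\<in>Obj J. Comp D (leg (M x) j) u = under (leg N j) x)"
    have Q: "\<exists>!u. ?Q x u" if x: "x \<in> Obj C" for x
    proof -
      have "Comp D (under (farr F k) x) (under (leg N i) x) = under (leg N j) x"
        if k: "k \<in> hom J i j" for k i j
      proof -
        have "under (Comp (functor_cat C D) (farr F k) (leg N i)) x = under (leg N j) x"
          using N.leg_natural[OF k] by simp
        then show ?thesis using x by simp
      qed
      from limit_coneD[OF lim[OF x] coneI[OF x aN.fobj_Obj[OF x] nat_transf.component_in[OF N_leg(1) x] this]]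
      show ?thesis by (simp cong: conj_cong)
    qed
    \<comment> \<open>The components are found separately at each object; joint monicity of the legs
      then forces naturality.\<close>
    define \<theta> where "\<theta> = (\<lambda>x\<in>Obj C. THE u. ?Q x u)"
    have \<theta>: "\<theta> x \<in> hom D (fobj (apex N) x) (apex (M x))"
      "\<And>j. j \<in> Obj J \<Longrightarrow> Comp D (leg (M x) j) (\<theta> x) = under (leg N j) x" if x: "x \<in> Obj C" for x
      using theI'[OF Q[OF x]] x by (simp_all add: \<theta>_def)
    have nat: "nat_transf C D (apex N) L \<theta>"
    proof
      show "\<theta> \<in> extensional (Obj C)" by (simp add: \<theta>_def)
      show "\<theta> x \<in> hom D (fobj (apex N) x) (fobj L x)" if "x \<in> Obj C" for x
        using \<theta>(1) Lx that by simp
      fix f x y assume f: "f \<in> hom C x y"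
      note x = C.hom_objs(1)[OF f] and y = C.hom_objs(2)[OF f]
      show "Comp D (\<theta> y) (farr (apex N) f) = Comp D (farr L f) (\<theta> x)"
      proof (rule limit_cone_jointly_monic[OF lim[OF y] D.Comp_in[OF aN.farr_in[OF f] \<theta>(1)[OF y]]
            D.Comp_in[OF \<theta>(1)[OF x] Lf(1)[OF f]]])
        fix j assume j: "j \<in> Obj J"
        have "Comp D (leg (M y) j) (Comp D (\<theta> y) (farr (apex N) f))
            = Comp D (under (leg N j) y) (farr (apex N) f)"
          using D.Comp_assoc[OF aN.farr_in[OF f] \<theta>(1)[OF y] leg[OF y j]] \<theta>(2)[OF y j] by simp
        also have "\<dots> = Comp D (farr (fobj F j) f) (Comp D (leg (M x) j) (\<theta> x))"
          using nat_transf.naturality[OF N_leg(1)[OF j] f] \<theta>(2)[OF x j] by simp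
        also have "\<dots> = Comp D (Comp D (leg (M y) j) (farr L f)) (\<theta> x)"
          using D.Comp_assoc[OF \<theta>(1)[OF x] leg[OF x j] cat_functor.farr_in[OF Fj[OF j] f]] Lf(2)[OF f j]
          by simp
        also have "\<dots> = Comp D (leg (M y) j) (Comp D (farr L f) (\<theta> x))"
          using D.Comp_assoc[OF \<theta>(1)[OF x] Lf(1)[OF f] leg[OF y j]] by simp
        finally show "Comp D (leg (M y) j) (Comp D (\<theta> y) (farr (apex N) f))
            = Comp D (leg (M y) j) (Comp D (farr L f) (\<theta> x))" .
      qed
    qed
    show "\<exists>!u. u \<in> hom (functor_cat C D) (apex N) (apex ?M) \<and>
        (\<forall>j\<in>Obj J. Comp (functor_cat C D) (leg ?M j) u = leg N j)"
    proof (rule ex1I[of _ "Arrow (apex N) \<theta> L"])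
      have "Arrow (apex N) (\<lambda>x\<in>Obj C. Comp D (leg (M x) j) (\<theta> x)) (fobj F j) = leg N j"
        if j: "j \<in> Obj J" for j
      proof -
        have "(\<lambda>x\<in>Obj C. Comp D (leg (M x) j) (\<theta> x)) = under (leg N j)"
          using \<theta>(2) j nat_transf.component_ext[OF N_leg(1)[OF j]]
          by (auto intro!: extensionalityI[of _ "Obj C"])
        then show ?thesis using N_leg(2,3)[OF j] by (cases "leg N j") simp
      qed
      then show "Arrow (apex N) \<theta> L \<in> hom (functor_cat C D) (apex N) (apex ?M) \<and>
          (\<forall>j\<in>Obj J. Comp (functor_cat C D) (leg ?M j) (Arrow (apex N) \<theta> L) = leg N j)"
        using nat by (simp add: hom_functor_cat_iff cong: restrict_cong)
    next
      fix w assume w: "w \<in> hom (functor_cat C D) (apex N) (apex ?M) \<and>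
        (\<forall>j\<in>Obj J. Comp (functor_cat C D) (leg ?M j) w = leg N j)"
      then interpret w: nat_transf C D "apex N" L "under w"
        by (simp add: hom_functor_cat_iff)
      have "under w = \<theta>"
      proof (rule extensionalityI[OF w.component_ext])
        show "\<theta> \<in> extensional (Obj C)" by (simp add: \<theta>_def)
        fix x assume x: "x \<in> Obj C"
        have "Comp D (leg (M x) j) (under w x) = under (leg N j) x" if j: "j \<in> Obj J" for j
        proof -
          have "under (Comp (functor_cat C D) (leg ?M j) w) x = under (leg N j) x"
            using w j by simp
          then show ?thesis using x j by simp
        qed
        then have "?Q x (under w x)"
          using w.component_in[OF x] Lx[OF x] by simp
        then show "under w x = \<theta> x"
          using Q[OF x] \<theta>[OF x] by blast
      qed
      then show "w = Arrow (apex N) \<theta> L"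
        using w by (cases w) (simp add: hom_functor_cat_iff)
    qed
  qed
  with Lx show ?thesis by (rule that)
qed

section \<open>Limits of small sets\<close>

text \<open>A set of functions or families can enter the universe only through an encoding into its
  element type; this form makes the encoding available to be chosen.\<close>

lemma small_iff_encoding:
  assumes "set_universe U"
  shows "small U X \<longleftrightarrow> (\<exists>e. inj_on e X \<and> e ` X \<in> U)"
  by (auto simp: small_def eqpoll_def bij_betw_def)

lemma small_inj_on:
  assumes U: "set_universe U" and Y: "small U Y" and f: "inj_on f X" "f ` X \<subseteq> Y"
  shows "small U X"
proof -
  obtain e where e: "inj_on e Y" "e ` Y \<in> U"
    using Y small_iff_encoding[OF U] by blast
  have "inj_on (e \<circ> f) X"
    using f e(1) by (auto intro: comp_inj_on inj_on_subset)
  moreover have "(e \<circ> f) ` X \<in> U"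
    by (rule set_universe.subset[OF U e(2)]) (use f(2) in auto)
  ultimately show ?thesis
    using small_iff_encoding[OF U] by blast
qed

lemma small_Pow:
  assumes U: "set_universe U" and X: "small U X"
  shows "small U (Pow X)"
proof -
  obtain A where A: "A \<in> U" "X \<approx> A"
    using X by (auto simp: small_def)
  obtain B where B: "B \<in> U" "Pow A \<approx> B"
    using set_universe.pow[OF U A(1)] by blast
  have "Pow X \<approx> Pow A"
    using A(2) bij_betw_Pow by (auto simp: eqpoll_def)
  then show ?thesis
    using B eqpoll_trans by (auto simp: small_def)
qed

text \<open>Closure under indexed unions is applied to a two-element index set that selects
  \<open>A\<close> at one index and \<open>B\<close> at the other.\<close>

lemma universe_Un:
  assumes U: "set_universe U" and A: "A \<in> U" and B: "B \<in> U"
  shows "A \<union> B \<in> U"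
proof -
  \<comment> \<open>A one-element type is excluded: the power set of a singleton has two members and
    must embed into the element type.\<close>
  have "\<exists>x y :: 'a. x \<noteq> y"
  proof -
    have "{undefined} \<in> U"
      using set_universe.pair[OF U, of undefined undefined] by simp
    then obtain C :: "'a set" where "Pow {undefined :: 'a} \<approx> C"
      using set_universe.pow[OF U] by meson
    then obtain e :: "'a set \<Rightarrow> 'a" where "inj_on e (Pow {undefined})"
      by (auto simp: eqpoll_def bij_betw_def)
    then have "e {} \<noteq> e {undefined}"
      by (auto dest: inj_onD)
    then show ?thesis by blast
  qed
  then obtain x y :: 'a where "x \<noteq> y" by blast
  then show ?thesis
    using set_universe.union[OF U set_universe.pair[OF U, of x y], of "\<lambda>a. if a = x then A else B"] A B
    by (auto simp: Un_commute)
qed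

text \<open>Kuratowski pairs embed the product into the double power set of the union.\<close>

lemma small_Times:
  assumes U: "set_universe U" and A: "A \<in> U" and B: "B \<in> U"
  shows "small U (A \<times> B)"
proof (rule small_inj_on[OF U])
  have "small U (A \<union> B)"
    using universe_Un[OF assms] by (auto simp: small_def)
  then show "small U (Pow (Pow (A \<union> B)))"
    by (intro small_Pow[OF U])
  have "a = c \<and> b = d" if "{{a}, {a, b}} = {{c}, {c, d}}" for a b c d :: 'a
    using that by (metis doubleton_eq_iff insert_absorb2)
  then show "inj_on (\<lambda>(a, b). {{a}, {a, b}}) (A \<times> B)"
    unfolding inj_on_def by (auto simp del: insert_iff singleton_insert_inj_eq)
  show "(\<lambda>(a, b). {{a}, {a, b}}) ` (A \<times> B) \<subseteq> Pow (Pow (A \<union> B))"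
    by auto
qed

text \<open>The power set has room for one more element: old elements go to their singletons and the
  new one to the empty set. Hence finite shapes are small even in a universe of finite sets.\<close>

lemma small_finite:
  assumes U: "set_universe U" and X: "finite X"
  shows "small U X"
  using X
proof induction
  case empty
  have "{} \<in> U"
    using set_universe.subset[OF U set_universe.pair[OF U, of undefined undefined]] by blast
  then show ?case
    unfolding small_iff_encoding[OF U] by simp
next
  case (insert a X)
  show ?case
  proof (rule small_inj_on[OF U small_Pow[OF U insert.IH]])
    show "inj_on (\<lambda>x. if x = a then {} else {x}) (insert a X)"
      by (auto simp: inj_on_def)
  qed auto
qed

text \<open>A dependent function is determined by its graph, a subset of a binary product. Indices
  are replaced by their codes under \<open>e\<close>, because \<open>small_Times\<close> expects
  both factors to be members of \<open>U\<close>.\<close>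

lemma small_PiE:
  assumes U: "set_universe U" and I: "small U I" and A: "\<And>i. i \<in> I \<Longrightarrow> A i \<in> U"
  shows "small U (Pi\<^sub>E I A)"
proof -
  obtain e where e: "inj_on e I" "e ` I \<in> U"
    using I small_iff_encoding[OF U] by blast
  \<comment> \<open>The union runs over codes, since \<open>union\<close> asks for an index set in
    \<open>U\<close>; \<open>inv_into\<close> recovers the index.\<close>
  define W where "W = (\<Union>a\<in>e ` I. A (inv_into I e a))"
  have W: "W \<in> U"
    unfolding W_def using e A by (intro set_universe.union[OF U]) auto
  have A_W: "A i \<subseteq> W" if "i \<in> I" for i
    using that e(1) by (auto simp: W_def)
  let ?graph = "\<lambda>\<psi>. (\<lambda>i. (e i, \<psi> i)) ` I"
  show ?thesis
  proof (rule small_inj_on[OF U small_Pow[OF U small_Times[OF U e(2) W]]])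
    show "inj_on ?graph (Pi\<^sub>E I A)"
    proof (rule inj_onI)
      fix \<phi> \<psi> assume \<phi>: "\<phi> \<in> Pi\<^sub>E I A" and \<psi>: "\<psi> \<in> Pi\<^sub>E I A" and eq: "?graph \<phi> = ?graph \<psi>"
      show "\<phi> = \<psi>"
      proof (rule PiE_ext[OF \<phi> \<psi>])
        fix i assume i: "i \<in> I"
        then have "(e i, \<phi> i) \<in> ?graph \<psi>" using eq by blast
        then show "\<phi> i = \<psi> i" using e(1) i by (auto dest: inj_onD)
      qed
    qed
    show "?graph ` Pi\<^sub>E I A \<subseteq> Pow (e ` I \<times> W)"
      using A_W by (auto simp: PiE_iff)
  qed
qed

section \<open>The category of sets and its limits\<close>

lemma set_cat_simps [simp]:
  "Obj (set_cat U) = U"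
  "Dom (set_cat U) = source"
  "Cod (set_cat U) = target"
  "Ident (set_cat U) A = Arrow A (restrict id A) A"
  "Comp (set_cat U) g f = Arrow (source f) (compose (source f) (under g) (under f)) (target g)"
  by (simp_all add: set_cat_def)

lemma hom_set_cat_iff:
  "f \<in> hom (set_cat U) A B \<longleftrightarrow>
    source f = A \<and> target f = B \<and> A \<in> U \<and> B \<in> U \<and> under f \<in> A \<rightarrow>\<^sub>E B"
  by (cases f) (auto simp: set_cat_def hom_def)

lemma hom_set_cat_eqI:
  assumes "f \<in> hom (set_cat U) A B" "g \<in> hom (set_cat U) A B"
    and "\<And>a. a \<in> A \<Longrightarrow> under f a = under g a"
  shows "f = g"
proof -
  have "under f = under g"
    using assms by (intro PiE_ext[of _ A "\<lambda>_. B"]) (auto simp: hom_set_cat_iff)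
  then show ?thesis
    using assms(1,2) by (cases f; cases g) (auto simp: hom_set_cat_iff)
qed

lemma category_set_cat: "category (set_cat U)"
proof
  fix f g A B C assume "f \<in> hom (set_cat U) A B" "g \<in> hom (set_cat U) B C"
  then show "Comp (set_cat U) g f \<in> hom (set_cat U) A C"
    by (auto simp: hom_set_cat_iff compose_def PiE_iff)
next
  fix f g h A B C D assume "f \<in> hom (set_cat U) A B" "g \<in> hom (set_cat U) B C" "h \<in> hom (set_cat U) C D"
  then show "Comp (set_cat U) h (Comp (set_cat U) g f) = Comp (set_cat U) (Comp (set_cat U) h g) f"
    by (auto simp: hom_set_cat_iff compose_def PiE_iff intro!: restrict_ext)
next
  fix f A B assume f: "f \<in> hom (set_cat U) A B"
  have "compose A (restrict id B) (under f) = under f" "compose A (under f) (restrict id A) = under f"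
    using f by (auto simp: hom_set_cat_iff compose_def PiE_iff intro!: extensionalityI[of _ A])
  then show "Comp (set_cat U) (Ident (set_cat U) B) f = f" "Comp (set_cat U) f (Ident (set_cat U) A) = f"
    using f by (cases f; simp add: hom_set_cat_iff)+
qed (auto simp: hom_set_cat_iff, auto simp: set_cat_def)

text \<open>The compatible families form a subset of the product over the objects of
  \<open>J\<close>, hence a small set. They are functions, so the apex is their image under an
  encoding, and the legs decode before projecting.\<close>

lemma set_cat_has_limit:
  assumes U: "set_universe U" and F: "cat_functor J (set_cat U) F" and J: "small U (Obj J)"
  shows "has_limit J (set_cat U) F"
proof -
  interpret F: cat_functor J "set_cat U" F by fact
  have obj: "fobj F j \<in> U" if "j \<in> Obj J" for j
    using F.fobj_Obj[OF that] by simp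
  have arr: "source (farr F k) = fobj F i" "target (farr F k) = fobj F j"
    "under (farr F k) \<in> fobj F i \<rightarrow>\<^sub>E fobj F j" if "k \<in> hom J i j" for k i j
    using F.farr_in[OF that] by (simp_all add: hom_set_cat_iff)
  define L where "L = {\<phi> \<in> (\<Pi>\<^sub>E j\<in>Obj J. fobj F j).
    \<forall>k\<in>Arr J. under (farr F k) (\<phi> (Dom J k)) = \<phi> (Cod J k)}"
  have "small U L"
    by (rule small_inj_on[OF U small_PiE[OF U J obj], of id]) (auto simp: L_def)
  then obtain e where e: "inj_on e L" "e ` L \<in> U"
    using small_iff_encoding[OF U] by blast
  let ?d = "inv_into L e"
  have d: "?d a \<in> L" "e (?d a) = a" if "a \<in> e ` L" for a
    using inv_into_into[OF that] f_inv_into_f[OF that] by auto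
  have L: "\<phi> j \<in> fobj F j" if "\<phi> \<in> L" "j \<in> Obj J" for \<phi> j
    using that by (auto simp: L_def)
  have L_nat: "under (farr F k) (\<phi> i) = \<phi> j" if "\<phi> \<in> L" "k \<in> hom J i j" for \<phi> i j k
    using that by (auto simp: L_def hom_iff)
  define M where "M = \<lparr>apex = e ` L, leg = (\<lambda>j\<in>Obj J. Arrow (e ` L) (\<lambda>a\<in>e ` L. ?d a j) (fobj F j))\<rparr>"
  have M: "is_cone J (set_cat U) F M"
  proof
    show "apex M \<in> Obj (set_cat U)" using e(2) by (simp add: M_def)
    show "leg M \<in> extensional (Obj J)" by (simp add: M_def)
  next
    fix j assume "j \<in> Obj J"
    then show "leg M j \<in> hom (set_cat U) (apex M) (fobj F j)"
      using e obj L by (auto simp: M_def hom_set_cat_iff)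
  next
    fix k i j assume k: "k \<in> hom J i j"
    have "compose (e ` L) (under (farr F k)) (\<lambda>a\<in>e ` L. ?d a i) = (\<lambda>a\<in>e ` L. ?d a j)"
      using L_nat[OF d(1) k] by (auto simp: compose_def intro!: restrict_ext)
    then show "Comp (set_cat U) (farr F k) (leg M i) = leg M j"
      using F.source.hom_objs[OF k] arr(2)[OF k] by (simp add: M_def)
  qed
  have "is_limit_cone J (set_cat U) F M"
    unfolding is_limit_cone_def
  proof (intro conjI allI impI M)
    fix N assume N: "is_cone J (set_cat U) F N"
    interpret N: is_cone J "set_cat U" F N by fact
    have N_leg: "source (leg N j) = apex N" "target (leg N j) = fobj F j"
      "under (leg N j) \<in> apex N \<rightarrow>\<^sub>E fobj F j" if "j \<in> Obj J" for j
      using N.leg_in[OF that] by (simp_all add: hom_set_cat_iff)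
    \<comment> \<open>The mediating map sends \<open>a\<close> to the family of its values under the
      legs of \<open>N\<close>.\<close>
    let ?t = "\<lambda>a. \<lambda>j\<in>Obj J. under (leg N j) a"
    have t: "?t a \<in> L" if a: "a \<in> apex N" for a
    proof -
      have "under (farr F k) (?t a (Dom J k)) = ?t a (Cod J k)" if "k \<in> Arr J" for k
      proof -
        have k: "k \<in> hom J (Dom J k) (Cod J k)" using that by (simp add: hom_iff)
        have "under (Comp (set_cat U) (farr F k) (leg N (Dom J k))) a = under (leg N (Cod J k)) a"
          using N.leg_natural[OF k] by simp
        then show ?thesis
          using a F.source.hom_objs[OF k] N_leg(1) by (simp add: compose_def)
      qed
      then show ?thesis
        using a N_leg(3) by (auto simp: L_def)
    qed
    let ?u = "Arrow (apex N) (\<lambda>a\<in>apex N. e (?t a)) (e ` L)"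
    have u: "?u \<in> hom (set_cat U) (apex N) (apex M)"
      using N.apex_in e(2) t by (auto simp: hom_set_cat_iff M_def)
    show "\<exists>!u. u \<in> hom (set_cat U) (apex N) (apex M) \<and>
        (\<forall>j\<in>Obj J. Comp (set_cat U) (leg M j) u = leg N j)"
    proof (rule ex1I[of _ ?u], intro conjI ballI u)
      fix j assume j: "j \<in> Obj J"
      have "under (Comp (set_cat U) (leg M j) ?u) a = under (leg N j) a" if "a \<in> apex N" for a
        using t[OF that] that j e(1) by (simp add: M_def compose_def)
      then show "Comp (set_cat U) (leg M j) ?u = leg N j"
        using hom_set_cat_eqI[OF F.target.Comp_in[OF u is_cone.leg_in[OF M j]] N.leg_in[OF j]] by blast
    next
      fix w assume w: "w \<in> hom (set_cat U) (apex N) (apex M) \<and>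
        (\<forall>j\<in>Obj J. Comp (set_cat U) (leg M j) w = leg N j)"
      show "w = ?u"
      proof (rule hom_set_cat_eqI[OF _ u])
        show "w \<in> hom (set_cat U) (apex N) (apex M)" using w by blast
        then have w_in: "source w = apex N" "under w \<in> apex N \<rightarrow>\<^sub>E e ` L"
          by (simp_all add: hom_set_cat_iff M_def)
        fix a assume a: "a \<in> apex N"
        then have wa: "under w a \<in> e ` L" using w_in(2) by auto
        have "?d (under w a) = ?t a"
        proof (rule PiE_ext)
          show "?d (under w a) \<in> Pi\<^sub>E (Obj J) (fobj F)" "?t a \<in> Pi\<^sub>E (Obj J) (fobj F)"
            using d(1)[OF wa] t[OF a] by (auto simp: L_def)
          fix j assume j: "j \<in> Obj J"
          then have "under (Comp (set_cat U) (leg M j) w) a = under (leg N j) a"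
            using w by simp
          then show "?d (under w a) j = ?t a j"
            using a j wa w_in(1) by (simp add: M_def compose_def)
        qed
        then show "under w a = under ?u a"
          using d(2)[OF wa] a by simp
      qed
    qed
  qed
  then show ?thesis by (auto simp: has_limit_def)
qed

lemma functor_cat_set_cat_has_limit:
  assumes U: "set_universe U" and F: "cat_functor J (functor_cat C (set_cat U)) F"
    and C: "category C" and J: "small U (Obj J)"
  shows "has_limit J (functor_cat C (set_cat U)) F"
proof -
  have "\<exists>M. is_limit_cone J (set_cat U) (eval_diagram J F x) M" if "x \<in> Obj C" for x
    using set_cat_has_limit[OF U cat_functor_eval_diagram[OF F category_set_cat that] J]
    by (simp add: has_limit_def)
  then obtain M where "\<And>x. x \<in> Obj C \<Longrightarrow> is_limit_cone J (set_cat U) (eval_diagram J F x) (M x)"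
    by metis
  from pointwise_limit[OF F C category_set_cat this] show ?thesis
    unfolding has_limit_def by blast
qed

section \<open>The terminal acset\<close>

lemma acset_simps [simp]:
  "Obj (acset_cat U X S K) = {G. is_acset U X S K G}"
  "Dom (acset_cat U X S K) = source"
  "Cod (acset_cat U X S K) = target"
  "Ident (acset_cat U X S K) = Ident (functor_cat X (set_cat U))"
  "Comp (acset_cat U X S K) = Comp (functor_cat X (set_cat U))"
  by (simp_all add: acset_cat_def functor_cat_def)

lemma hom_acset_iff:
  "f \<in> hom (acset_cat U X S K) G H \<longleftrightarrow> f \<in> hom (functor_cat X (set_cat U)) G H \<and>
    is_acset U X S K G \<and> is_acset U X S K H \<and>
    (\<forall>s\<in>Obj (fiber X S 1). under f s = Ident (set_cat U) (fobj K s))"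
  by (cases f) (auto simp: acset_cat_def functor_cat_def hom_def)

section \<open>The attribute fiber and the category of acsets\<close>

locale acset_schema =
  fixes U :: "'u set set"
    and X :: "('o, 'a) cat"
    and S :: "('o, 'a, nat, nat \<times> nat) func"
    and K :: "('o, 'a, 'u) setfunc"
  assumes set_universe: "set_universe U"
    and schema: "schema U X S"
    and typing: "cat_functor (fiber X S 1) (set_cat U) K"

sublocale acset_schema \<subseteq> X: category X
  using schema by (simp add: schema_def small_category_def)

sublocale acset_schema \<subseteq> S: cat_functor X interval_cat S
  using schema by (simp add: schema_def)

sublocale acset_schema \<subseteq> K: cat_functor "fiber X S 1" "set_cat U" K
  by (rule typing)

context acset_schema
begin

declare One_nat_def [simp del]

abbreviation (input) "Set \<equiv> set_cat U"
abbreviation (input) "SetX \<equiv> functor_cat X (set_cat U)"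
abbreviation (input) "Acset \<equiv> acset_cat U X S K"

definition "attrs = {s \<in> Obj X. fobj S s = 1}"

lemma Obj_fiber: "Obj (fiber X S 1) = attrs"
  by (simp add: fiber_def attrs_def)

lemma Ident_fiber: "Ident (fiber X S 1) = Ident X"
  by (simp add: fiber_def)

lemma attrs_Obj: "s \<in> attrs \<Longrightarrow> s \<in> Obj X"
  by (simp add: attrs_def)

lemma K_in_U: "s \<in> attrs \<Longrightarrow> fobj K s \<in> U"
  using K.fobj_Obj by (simp add: Obj_fiber)

lemma Arr_fiber: "Arr (fiber X S 1) = Ident X ` attrs"
  using schema by (auto simp: schema_def discrete_category_def Ident_fiber Obj_fiber)

text \<open>Only the identity leaves 1 in the interval category, so an arrow out of an attribute
  type lies in the fiber over 1, where discreteness makes it an identity.\<close>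

lemma arr_from_attr:
  assumes f: "f \<in> hom X s y" and s: "s \<in> attrs"
  shows "y = s" "f = Ident X s"
proof -
  have "farr S f \<in> hom interval_cat 1 (fobj S y)"
    using S.farr_in[OF f] s by (simp add: attrs_def)
  then have "farr S f = Ident interval_cat 1"
    by (auto simp: hom_def interval_cat_def)
  then have "f \<in> Arr (fiber X S 1)"
    using f by (simp add: fiber_def hom_iff)
  then obtain t where t: "t \<in> attrs" "f = Ident X t"
    by (auto simp: Arr_fiber)
  then have "f \<in> hom X t t" using X.Ident_in attrs_Obj by blast
  with f t show "y = s" "f = Ident X s" by (auto simp: hom_iff)
qed

text \<open>The fiber over 1 has only identity arrows and functors preserve these, so agreement with
  \<open>K\<close> on objects implies agreement on arrows.\<close>

lemma acset_iff:
  "is_acset U X S K G \<longleftrightarrow> cat_functor X Set G \<and> (\<forall>s\<in>attrs. fobj G s = fobj K s)"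
proof (cases "cat_functor X Set G")
  case True
  interpret G: cat_functor X Set G by fact
  have "restrict_func G (fiber X S 1) = K" if eq: "\<forall>s\<in>attrs. fobj G s = fobj K s"
  proof (rule func.equality)
    show "fobj (restrict_func G (fiber X S 1)) = fobj K"
      using eq K.fobj_in by (auto simp: restrict_func_def Obj_fiber PiE_iff intro!: extensionalityI[of _ attrs])
    have "farr G f = farr K f" if f: "f \<in> Arr (fiber X S 1)" for f
    proof -
      obtain s where s: "s \<in> attrs" "f = Ident X s"
        using f by (auto simp: Arr_fiber)
      then show ?thesis
        using G.farr_Ident[OF attrs_Obj] K.farr_Ident[of s] eq by (simp add: Obj_fiber Ident_fiber)
    qed
    then show "farr (restrict_func G (fiber X S 1)) = farr K"
      using K.farr_ext by (auto simp: restrict_func_def intro!: extensionalityI[of _ "Arr (fiber X S 1)"])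
  qed simp
  moreover have "fobj G s = fobj K s" if "restrict_func G (fiber X S 1) = K" "s \<in> attrs" for s
  proof -
    have "fobj (restrict_func G (fiber X S 1)) s = fobj K s" using that by simp
    then show ?thesis using that(2) by (simp add: restrict_func_def Obj_fiber)
  qed
  ultimately show ?thesis using True by (auto simp: is_acset_def)
qed (simp add: is_acset_def)

lemma acset_functor: "is_acset U X S K G \<Longrightarrow> cat_functor X Set G"
  by (simp add: is_acset_def)

lemma category_acset: "category Acset"
proof -
  interpret F: category SetX by (rule category_functor_cat)
  show ?thesis
  proof
    fix f g G H L assume f: "f \<in> hom Acset G H" and g: "g \<in> hom Acset H L"
    have "Comp Set (Ident Set A) (Ident Set A) = Ident Set A" for A
      by (simp add: compose_def cong: restrict_cong)
    then show "Comp Acset g f \<in> hom Acset G L"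
      using f g F.Comp_in[of f G H g L] attrs_Obj
      by (auto simp: hom_acset_iff Obj_fiber simp del: set_cat_simps)
  next
    fix f g h G H L M assume "f \<in> hom Acset G H" "g \<in> hom Acset H L" "h \<in> hom Acset L M"
    then show "Comp Acset h (Comp Acset g f) = Comp Acset (Comp Acset h g) f"
      using F.Comp_assoc[of f G H g L h M] by (simp only: hom_acset_iff acset_simps)
  next
    fix f G H assume "f \<in> hom Acset G H"
    then show "Comp Acset (Ident Acset H) f = f" "Comp Acset f (Ident Acset G) = f"
      using F.Ident_left[of f G H] F.Ident_right[of f G H] by (simp_all only: hom_acset_iff acset_simps)
  next
    fix G assume "G \<in> Obj Acset"
    then show "Ident Acset G \<in> hom Acset G G"
      using F.Ident_in[of G] attrs_Obj by (auto simp: hom_acset_iff acset_iff Obj_fiber)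
  qed (auto simp: acset_cat_def functor_cat_def)
qed

section \<open>Families of attribute values and their encodings\<close>

definition "attr_arrs x = {f \<in> Arr X. Dom X f = x \<and> Cod X f \<in> attrs}"

text \<open>This is the value at \<open>x\<close> of the right Kan extension of \<open>K\<close>
  along the inclusion of S_1: as S_1 is discrete, the limit over the comma category is a plain
  product.\<close>

definition "attr_vals x = (\<Pi>\<^sub>E f\<in>attr_arrs x. fobj K (Cod X f))"

text \<open>On attribute types the only arrow is the identity, and the encoding is chosen so that the
  terminal acset restricts to \<open>K\<close> on the nose.\<close>

definition "enc x = (if x \<in> attrs then (\<lambda>\<psi>. \<psi> (Ident X x))
  else (SOME e. inj_on e (attr_vals x) \<and> e ` attr_vals x \<in> U))"

lemma attr_arrs_attr: "s \<in> attrs \<Longrightarrow> attr_arrs s = {Ident X s}"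
  using arr_from_attr(2)[of _ s] X.Ident_in[OF attrs_Obj] by (fastforce simp: attr_arrs_def hom_iff)

text \<open>The only coordinate is the identity of \<open>s\<close>, and evaluation at it identifies
  the families with the elements of \<open>fobj K s\<close>.\<close>

lemma enc_attr_image:
  assumes s: "s \<in> attrs"
  shows "enc s ` attr_vals s = fobj K s"
proof -
  have "Cod X (Ident X s) = s"
    using X.Ident_in[OF attrs_Obj[OF s]] by (simp add: hom_iff)
  then have "a \<in> enc s ` attr_vals s" if "a \<in> fobj K s" for a
    using s that by (intro image_eqI[of _ _ "\<lambda>f\<in>{Ident X s}. a"]) (auto simp: attr_vals_def attr_arrs_attr enc_def)
  moreover have "enc s \<psi> \<in> fobj K s" if "\<psi> \<in> attr_vals s" for \<psi>
    using s that \<open>Cod X (Ident X s) = s\<close> by (auto simp: attr_vals_def attr_arrs_attr enc_def PiE_iff)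
  ultimately show ?thesis by blast
qed

text \<open>At an attribute type the encoding reads off the only coordinate and is thus injective.
  Elsewhere an encoding exists because a product of members of \<open>U\<close> over a small set of
  arrows is small.\<close>

lemma enc:
  assumes x: "x \<in> Obj X"
  shows "inj_on (enc x) (attr_vals x)" "enc x ` attr_vals x \<in> U"
proof -
  have "inj_on (enc x) (attr_vals x) \<and> enc x ` attr_vals x \<in> U"
  proof (cases "x \<in> attrs")
    case True
    then have "inj_on (enc x) (attr_vals x)"
      by (auto simp: inj_on_def attr_vals_def attr_arrs_attr enc_def intro!: PiE_ext[of _ "{Ident X x}"])
    with True show ?thesis by (simp add: enc_attr_image K_in_U)
  next
    case False
    have "small U (Arr X)"
      using schema by (simp add: schema_def small_category_def)
    then have "small U (attr_arrs x)"
      by (rule small_inj_on[OF set_universe, of _ id]) (auto simp: attr_arrs_def)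
    then have "small U (attr_vals x)"
      unfolding attr_vals_def
      by (rule small_PiE[OF set_universe]) (simp add: attr_arrs_def K_in_U)
    then have "\<exists>e. inj_on e (attr_vals x) \<and> e ` attr_vals x \<in> U"
      by (simp add: small_iff_encoding[OF set_universe])
    then have "inj_on (SOME e. inj_on e (attr_vals x) \<and> e ` attr_vals x \<in> U) (attr_vals x) \<and>
        (SOME e. inj_on e (attr_vals x) \<and> e ` attr_vals x \<in> U) ` attr_vals x \<in> U"
      by (rule someI_ex)
    with False show ?thesis by (simp add: enc_def)
  qed
  then show "inj_on (enc x) (attr_vals x)" "enc x ` attr_vals x \<in> U" by blast+
qed

definition "dec x = inv_into (attr_vals x) (enc x)"

lemma dec_enc: "x \<in> Obj X \<Longrightarrow> \<psi> \<in> attr_vals x \<Longrightarrow> dec x (enc x \<psi>) = \<psi>"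
  by (simp add: dec_def enc)

lemma dec_in: "a \<in> enc x ` attr_vals x \<Longrightarrow> dec x a \<in> attr_vals x"
  by (simp add: dec_def inv_into_into)

lemma attr_valsD: "\<psi> \<in> attr_vals x \<Longrightarrow> f \<in> attr_arrs x \<Longrightarrow> \<psi> f \<in> fobj K (Cod X f)"
  by (auto simp: attr_vals_def)

text \<open>The covariant action of \<open>f\<close> on families: an attribute arrow out of the
  codomain is first precomposed with \<open>f\<close>.\<close>

definition "pull f \<psi> = (\<lambda>g\<in>attr_arrs (Cod X f). \<psi> (Comp X g f))"

lemma Comp_attr_arrs:
  assumes f: "f \<in> hom X x y" and g: "g \<in> attr_arrs y"
  shows "Comp X g f \<in> attr_arrs x" "Cod X (Comp X g f) = Cod X g"
  using X.Comp_in[OF f, of g "Cod X g"] g by (auto simp: attr_arrs_def hom_iff)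

lemma pull_in:
  assumes f: "f \<in> hom X x y" and \<psi>: "\<psi> \<in> attr_vals x"
  shows "pull f \<psi> \<in> attr_vals y"
  using Comp_attr_arrs[OF f] attr_valsD[OF \<psi>] f
  by (fastforce simp: pull_def attr_vals_def hom_iff)

lemma attr_vals_eqI:
  "\<phi> \<in> attr_vals x \<Longrightarrow> \<psi> \<in> attr_vals x \<Longrightarrow> (\<And>f. f \<in> attr_arrs x \<Longrightarrow> \<phi> f = \<psi> f) \<Longrightarrow> \<phi> = \<psi>"
  unfolding attr_vals_def by (rule PiE_ext)

section \<open>The terminal acset and its universal property\<close>

definition terminal_acset :: "('o, 'a, 'u) setfunc" where
  "terminal_acset = \<lparr>fobj = (\<lambda>x\<in>Obj X. enc x ` attr_vals x),
    farr = (\<lambda>f\<in>Arr X. Arrow (enc (Dom X f) ` attr_vals (Dom X f))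
      (\<lambda>a\<in>enc (Dom X f) ` attr_vals (Dom X f). enc (Cod X f) (pull f (dec (Dom X f) a)))
      (enc (Cod X f) ` attr_vals (Cod X f)))\<rparr>"

abbreviation (input) "T \<equiv> terminal_acset"

lemma T_obj: "x \<in> Obj X \<Longrightarrow> fobj T x = enc x ` attr_vals x"
  by (simp add: terminal_acset_def)

lemma T_arr:
  assumes f: "f \<in> hom X x y"
  shows "farr T f \<in> hom Set (fobj T x) (fobj T y)"
    and "\<psi> \<in> attr_vals x \<Longrightarrow> under (farr T f) (enc x \<psi>) = enc y (pull f \<psi>)"
proof -
  note xy = X.hom_objs[OF f]
  show "farr T f \<in> hom Set (fobj T x) (fobj T y)"
    using f xy enc pull_in[OF f] dec_in[of _ x]
    by (auto simp: terminal_acset_def hom_iff[of f] hom_set_cat_iff dec_enc)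
  show "\<psi> \<in> attr_vals x \<Longrightarrow> under (farr T f) (enc x \<psi>) = enc y (pull f \<psi>)"
    using f xy by (auto simp: terminal_acset_def hom_iff dec_enc)
qed

text \<open>Functoriality comes from the unit and associativity laws for precomposition in
  \<open>pull\<close>, and agreement with \<open>K\<close> from \<open>enc_attr_image\<close>.
  Terminality itself is the content of \<open>bang\<close> and \<open>bang_unique\<close>.\<close>

lemma terminal_acset: "is_acset U X S K T"
proof -
  have "cat_functor X Set T"
  proof (intro cat_functor.intro cat_functor_axioms.intro X.category_axioms category_set_cat)
    show "fobj T \<in> Obj X \<rightarrow>\<^sub>E Obj Set"
      by (auto simp: terminal_acset_def enc)
    show "farr T \<in> extensional (Arr X)"
      by (simp add: terminal_acset_def)
    show "\<And>f x y. f \<in> hom X x y \<Longrightarrow> farr T f \<in> hom Set (fobj T x) (fobj T y)"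
      by (rule T_arr(1))
  next
    fix x assume x: "x \<in> Obj X"
    note i = X.Ident_in[OF x]
    have T_U: "fobj T x \<in> Obj Set" using x by (simp add: T_obj enc)
    show "farr T (Ident X x) = Ident Set (fobj T x)"
    proof (rule hom_set_cat_eqI[OF T_arr(1)[OF i]])
      show "Ident Set (fobj T x) \<in> hom Set (fobj T x) (fobj T x)"
        using category.Ident_in[OF category_set_cat T_U] .
      fix a assume "a \<in> fobj T x"
      then obtain \<psi> where \<psi>: "\<psi> \<in> attr_vals x" "a = enc x \<psi>" using x by (auto simp: T_obj)
      have "pull (Ident X x) \<psi> = \<psi>"
      proof (rule attr_vals_eqI[OF pull_in[OF i \<psi>(1)] \<psi>(1)])
        fix g assume g: "g \<in> attr_arrs x"
        then have "Comp X g (Ident X x) = g"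
          using X.Ident_right[of g x "Cod X g"] by (simp add: attr_arrs_def hom_iff)
        then show "pull (Ident X x) \<psi> g = \<psi> g"
          using g i by (simp add: pull_def hom_iff)
      qed
      then show "under (farr T (Ident X x)) a = under (Ident Set (fobj T x)) a"
        using T_arr(2)[OF i \<psi>(1)] \<psi> \<open>a \<in> fobj T x\<close> by simp
    qed
  next
    fix f g x y z assume f: "f \<in> hom X x y" and g: "g \<in> hom X y z"
    note gf = X.Comp_in[OF f g]
    show "farr T (Comp X g f) = Comp Set (farr T g) (farr T f)"
    proof (rule hom_set_cat_eqI[OF T_arr(1)[OF gf]])
      show "Comp Set (farr T g) (farr T f) \<in> hom Set (fobj T x) (fobj T z)"
        using category.Comp_in[OF category_set_cat T_arr(1)[OF f] T_arr(1)[OF g]] .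
      fix a assume a: "a \<in> fobj T x"
      then obtain \<psi> where \<psi>: "\<psi> \<in> attr_vals x" "a = enc x \<psi>"
        using X.hom_objs[OF f] by (auto simp: T_obj)
      have "pull (Comp X g f) \<psi> = pull g (pull f \<psi>)"
      proof (rule attr_vals_eqI[OF pull_in[OF gf \<psi>(1)] pull_in[OF g pull_in[OF f \<psi>(1)]]])
        fix h assume h: "h \<in> attr_arrs z"
        then have "Comp X (Comp X h g) f = Comp X h (Comp X g f)"
          using X.Comp_assoc[OF f g, of h "Cod X h"] by (simp add: attr_arrs_def hom_iff)
        then show "pull (Comp X g f) \<psi> h = pull g (pull f \<psi>) h"
          using h f g gf Comp_attr_arrs[OF g h] by (simp add: pull_def hom_iff)
      qed
      then show "under (farr T (Comp X g f)) a = under (Comp Set (farr T g) (farr T f)) a"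
        using T_arr(1)[OF f] T_arr(2)[OF gf \<psi>(1)] T_arr(2)[OF f \<psi>(1)] T_arr(2)[OF g pull_in[OF f \<psi>(1)]] a \<psi>(2)
        by (simp add: compose_def hom_set_cat_iff)
    qed
  qed
  then show ?thesis
    by (auto simp: acset_iff T_obj enc_attr_image attrs_Obj)
qed

text \<open>An element is sent to the code of the family of all attribute values that can be reached
  from it.\<close>

definition "bang G = (\<lambda>x\<in>Obj X. Arrow (fobj G x)
  (\<lambda>a\<in>fobj G x. enc x (\<lambda>f\<in>attr_arrs x. under (farr G f) a)) (fobj T x))"

text \<open>Naturality is the functoriality of \<open>G\<close> on an arrow followed by an attribute
  arrow. At an attribute type the family of \<open>a\<close> has the single coordinate
  \<open>a\<close>, and \<open>enc\<close> returns it, so the component is exactly an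
  identity.\<close>

lemma bang:
  assumes G: "is_acset U X S K G"
  shows "nat_transf X Set G T (bang G)"
    and "s \<in> attrs \<Longrightarrow> bang G s = Ident Set (fobj K s)"
proof -
  interpret G: cat_functor X Set G using acset_functor[OF G] .
  interpret T: cat_functor X Set T using acset_functor[OF terminal_acset] .
  have G_s: "fobj G s = fobj K s" if "s \<in> attrs" for s
    using G that by (simp add: acset_iff)
  let ?t = "\<lambda>x a. \<lambda>f\<in>attr_arrs x. under (farr G f) a"
  have t: "?t x a \<in> attr_vals x" if a: "a \<in> fobj G x" for x a
  proof -
    have "under (farr G f) a \<in> fobj K (Cod X f)" if f: "f \<in> attr_arrs x" for f
    proof -
      have "f \<in> hom X x (Cod X f)" "Cod X f \<in> attrs"
        using f by (simp_all add: attr_arrs_def hom_iff)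
      then show ?thesis
        using G.farr_in[of f x "Cod X f"] a G_s by (auto simp: hom_set_cat_iff)
    qed
    then show ?thesis by (auto simp: attr_vals_def)
  qed
  have in_hom: "bang G x \<in> hom Set (fobj G x) (fobj T x)" if x: "x \<in> Obj X" for x
    using x t G.fobj_Obj[OF x] T.fobj_Obj[OF x] by (auto simp: bang_def hom_set_cat_iff T_obj)
  have bang_app: "under (bang G x) a = enc x (?t x a)" if "x \<in> Obj X" "a \<in> fobj G x" for x a
    using that by (simp add: bang_def)
  show "nat_transf X Set G T (bang G)"
  proof
    show "bang G \<in> extensional (Obj X)" by (simp add: bang_def)
    show "\<And>x. x \<in> Obj X \<Longrightarrow> bang G x \<in> hom Set (fobj G x) (fobj T x)" by (rule in_hom)
  next
    fix f x y assume f: "f \<in> hom X x y"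
    note x = X.hom_objs(1)[OF f] and y = X.hom_objs(2)[OF f]
    show "Comp Set (bang G y) (farr G f) = Comp Set (farr T f) (bang G x)"
    proof (rule hom_set_cat_eqI)
      show "Comp Set (bang G y) (farr G f) \<in> hom Set (fobj G x) (fobj T y)"
        using K.target.Comp_in[OF G.farr_in[OF f] in_hom[OF y]] .
      show "Comp Set (farr T f) (bang G x) \<in> hom Set (fobj G x) (fobj T y)"
        using K.target.Comp_in[OF in_hom[OF x] T.farr_in[OF f]] .
      fix a assume a: "a \<in> fobj G x"
      have Gf: "source (farr G f) = fobj G x" "under (farr G f) a \<in> fobj G y"
        using G.farr_in[OF f] a by (auto simp: hom_set_cat_iff)
      have "?t y (under (farr G f) a) = pull f (?t x a)"
      proof (rule attr_vals_eqI[OF t[OF Gf(2)] pull_in[OF f t[OF a]]])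
        fix g assume g: "g \<in> attr_arrs y"
        then have "g \<in> hom X y (Cod X g)" by (simp add: attr_arrs_def hom_iff)
        from G.farr_Comp[OF f this]
        have "under (farr G (Comp X g f)) a = under (farr G g) (under (farr G f) a)"
          using a Gf(1) by (simp add: compose_def)
        then show "?t y (under (farr G f) a) g = pull f (?t x a) g"
          using g f Comp_attr_arrs[OF f g] by (simp add: pull_def hom_iff)
      qed
      then show "under (Comp Set (bang G y) (farr G f)) a = under (Comp Set (farr T f) (bang G x)) a"
        using a Gf in_hom[OF x] T_arr(2)[OF f t[OF a]] bang_app[OF x a] bang_app[OF y Gf(2)]
        by (simp add: compose_def hom_set_cat_iff)
    qed
  qed
  assume s: "s \<in> attrs"
  have T_s: "fobj T s = fobj K s" using s terminal_acset by (simp add: acset_iff)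
  show "bang G s = Ident Set (fobj K s)"
  proof (rule hom_set_cat_eqI)
    show "bang G s \<in> hom Set (fobj K s) (fobj K s)"
      using in_hom[OF attrs_Obj[OF s]] T_s G_s[OF s] by simp
    show "Ident Set (fobj K s) \<in> hom Set (fobj K s) (fobj K s)"
      using K.target.Ident_in K_in_U[OF s] by simp
    fix a assume a: "a \<in> fobj K s"
    show "under (bang G s) a = under (Ident Set (fobj K s)) a"
      using a s G_s[OF s] bang_app[OF attrs_Obj[OF s], of a] G.farr_Ident[OF attrs_Obj[OF s]]
      by (simp add: enc_def attr_arrs_attr)
  qed
qed

text \<open>Naturality along an arrow \<open>f\<close> from \<open>x\<close> to an attribute type,
  where \<alpha> is an identity, determines the \<open>f\<close>-coordinate of the family assigned
  to each element.\<close>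

lemma bang_unique:
  assumes \<alpha>: "nat_transf X Set G T \<alpha>" and id: "\<And>s. s \<in> attrs \<Longrightarrow> \<alpha> s = Ident Set (fobj K s)"
  shows "\<alpha> = bang G"
proof -
  interpret \<alpha>: nat_transf X Set G T \<alpha> by fact
  \<comment> \<open>An identity component at \<open>s\<close> forces \<open>G\<close> to have the
    value of \<open>K\<close> there, so \<open>G\<close> is an acset and the facts on
    \<open>bang G\<close> apply.\<close>
  have G_s: "fobj G s = fobj K s" if "s \<in> attrs" for s
    using \<alpha>.component_in[OF attrs_Obj[OF that]] id[OF that] by (simp add: hom_set_cat_iff)
  then have G: "is_acset U X S K G"
    using \<alpha>.F.cat_functor_axioms by (simp add: acset_iff)
  interpret b: nat_transf X Set G T "bang G" by (rule bang(1)[OF G])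
  show ?thesis
  proof (rule extensionalityI[OF \<alpha>.component_ext b.component_ext])
    fix x assume x: "x \<in> Obj X"
    show "\<alpha> x = bang G x"
    proof (rule hom_set_cat_eqI[OF \<alpha>.component_in[OF x] b.component_in[OF x]])
      fix a assume a: "a \<in> fobj G x"
      then have "under (\<alpha> x) a \<in> enc x ` attr_vals x"
        using \<alpha>.component_in[OF x] x by (auto simp: hom_set_cat_iff T_obj)
      then obtain \<psi> where \<psi>: "\<psi> \<in> attr_vals x" "under (\<alpha> x) a = enc x \<psi>"
        by blast
      have "\<psi> f = under (farr G f) a" if f: "f \<in> attr_arrs x" for f
      proof -
        let ?s = "Cod X f"
        have f': "f \<in> hom X x ?s" and s: "?s \<in> attrs"
          using f by (simp_all add: attr_arrs_def hom_iff)
        have G_f: "source (farr G f) = fobj G x" "under (farr G f) a \<in> fobj K ?s"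
          using \<alpha>.F.farr_in[OF f'] a G_s[OF s] by (auto simp: hom_set_cat_iff)
        have "under (Comp Set (\<alpha> ?s) (farr G f)) a = under (Comp Set (farr T f) (\<alpha> x)) a"
          by (simp only: \<alpha>.naturality[OF f'])
        then have "under (farr G f) a = under (farr T f) (enc x \<psi>)"
          using a \<psi>(2) G_f id[OF s] \<alpha>.component_in[OF x] by (simp add: compose_def hom_set_cat_iff)
        \<comment> \<open>The encoding at an attribute type is evaluation at the identity.\<close>
        also have "\<dots> = pull f \<psi> (Ident X ?s)"
          using T_arr(2)[OF f' \<psi>(1)] s by (simp add: enc_def)
        also have "\<dots> = \<psi> f"
          using s X.Ident_left[OF f'] by (simp add: pull_def attr_arrs_attr)
        finally show ?thesis by simp
      qed
      then have "\<psi> = (\<lambda>f\<in>attr_arrs x. under (farr G f) a)"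
        using \<psi>(1) by (auto simp: attr_vals_def PiE_iff intro!: extensionalityI[of _ "attr_arrs x"])
      then show "under (\<alpha> x) a = under (bang G x) a"
        using \<psi>(2) a x by (simp add: bang_def)
    qed
  qed
qed

section \<open>The embedding of acsets into the slice over the terminal acset\<close>

definition acset_to_slice where
  "acset_to_slice = \<lparr>fobj = (\<lambda>G\<in>Obj Acset. Arrow G (bang G) T),
    farr = (\<lambda>\<alpha>\<in>Arr Acset. Arrow (Arrow (source \<alpha>) (bang (source \<alpha>)) T) \<alpha>
      (Arrow (target \<alpha>) (bang (target \<alpha>)) T))\<rparr>"

abbreviation (input) "B \<equiv> acset_to_slice"

lemma B_obj: "is_acset U X S K G \<Longrightarrow> fobj B G = Arrow G (bang G) T"
  by (simp add: acset_to_slice_def)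

lemma B_arr: "\<alpha> \<in> hom Acset G H \<Longrightarrow> farr B \<alpha> = Arrow (Arrow G (bang G) T) \<alpha> (Arrow H (bang H) T)"
  by (simp add: acset_to_slice_def hom_iff)

lemma bang_hom: "is_acset U X S K G \<Longrightarrow> Arrow G (bang G) T \<in> hom SetX G T"
  using bang(1) by (simp add: hom_functor_cat_iff)

text \<open>Both sides are morphisms into the terminal acset that are identities at attribute types,
  so uniqueness applies.\<close>

lemma bang_comp:
  assumes \<alpha>: "\<alpha> \<in> hom Acset G H"
  shows "Comp SetX (Arrow H (bang H) T) \<alpha> = Arrow G (bang G) T"
proof -
  have H: "is_acset U X S K H" and \<alpha>': "\<alpha> \<in> hom SetX G H"
    and id: "\<And>s. s \<in> attrs \<Longrightarrow> under \<alpha> s = Ident Set (fobj K s)"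
    using \<alpha> by (simp_all add: hom_acset_iff Obj_fiber)
  have "(\<lambda>x\<in>Obj X. Comp Set (bang H x) (under \<alpha> x)) = bang G"
  proof (rule bang_unique)
    show "nat_transf X Set G T (\<lambda>x\<in>Obj X. Comp Set (bang H x) (under \<alpha> x))"
      using nat_transf_Comp[OF _ bang(1)[OF H]] \<alpha>'
      by (simp only: hom_functor_cat_iff)
    fix s assume s: "s \<in> attrs"
    have "Comp Set (Ident Set (fobj K s)) (Ident Set (fobj K s)) = Ident Set (fobj K s)"
      using K.target.Ident_left[OF K.target.Ident_in] K_in_U[OF s] by (simp del: set_cat_simps(4,5))
    then show "(\<lambda>x\<in>Obj X. Comp Set (bang H x) (under \<alpha> x)) s = Ident Set (fobj K s)"
      using attrs_Obj[OF s] id[OF s] bang(2)[OF H s] by (simp del: set_cat_simps)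
  qed
  then show ?thesis
    using \<alpha>' by (simp add: hom_functor_cat_iff)
qed

lemma fully_faithful_acset_to_slice: "fully_faithful Acset (slice_cat SetX T) B"
proof -
  interpret A: category Acset by (rule category_acset)
  interpret SL: category "slice_cat SetX T" using category_functor_cat by (rule category_slice)
  have B_hom: "farr B \<alpha> \<in> hom (slice_cat SetX T) (fobj B G) (fobj B H)"
    if \<alpha>: "\<alpha> \<in> hom Acset G H" for \<alpha> G H
  proof -
    have GH: "is_acset U X S K G" "is_acset U X S K H"
      using \<alpha> by (simp_all add: hom_acset_iff)
    moreover have "\<alpha> \<in> hom SetX G H" using \<alpha> by (simp add: hom_acset_iff)
    ultimately show ?thesis
      using B_obj B_arr[OF \<alpha>] bang_comp[OF \<alpha>] bang_hom[OF GH(1)] bang_hom[OF GH(2)]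
      by (simp add: hom_slice_iff hom_iff[of "Arrow G (bang G) T"] hom_iff[of "Arrow H (bang H) T"]
          del: functor_cat_simps(5))
  qed
  have B_functor: "cat_functor Acset (slice_cat SetX T) B"
  proof
    show "fobj B \<in> Obj Acset \<rightarrow>\<^sub>E Obj (slice_cat SetX T)"
      using bang_hom by (auto simp: acset_to_slice_def hom_iff)
    show "farr B \<in> extensional (Arr Acset)"
      by (simp add: acset_to_slice_def)
    show "\<And>\<alpha> G H. \<alpha> \<in> hom Acset G H \<Longrightarrow> farr B \<alpha> \<in> hom (slice_cat SetX T) (fobj B G) (fobj B H)"
      by (rule B_hom)
  next
    fix G assume "G \<in> Obj Acset"
    then show "farr B (Ident Acset G) = Ident (slice_cat SetX T) (fobj B G)"
      using B_arr[OF A.Ident_in] B_obj[of G] by simp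
  next
    fix \<alpha> \<beta> G H L assume \<alpha>: "\<alpha> \<in> hom Acset G H" and \<beta>: "\<beta> \<in> hom Acset H L"
    show "farr B (Comp Acset \<beta> \<alpha>) = Comp (slice_cat SetX T) (farr B \<beta>) (farr B \<alpha>)"
      using B_arr[OF A.Comp_in[OF \<alpha> \<beta>]] B_arr[OF \<alpha>] B_arr[OF \<beta>] by simp
  qed
  have "bij_betw (farr B) (hom Acset G H) (hom (slice_cat SetX T) (fobj B G) (fobj B H))"
    if "G \<in> Obj Acset" "H \<in> Obj Acset" for G H
  proof -
    have G: "is_acset U X S K G" and H: "is_acset U X S K H" using that by simp_all
    show ?thesis
    \<comment> \<open>The embedding only wraps a morphism together with the structure morphisms of
      its endpoints; \<open>under\<close> unwraps it.\<close>
    proof (rule bij_betw_byWitness[where f' = under])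
      show "\<forall>\<alpha>\<in>hom Acset G H. under (farr B \<alpha>) = \<alpha>"
        using B_arr by auto
      show "farr B ` hom Acset G H \<subseteq> hom (slice_cat SetX T) (fobj B G) (fobj B H)"
        using B_hom by blast
      have under_hom: "under h \<in> hom Acset G H"
        if h: "h \<in> hom (slice_cat SetX T) (fobj B G) (fobj B H)" for h
      proof -
        have \<alpha>: "under h \<in> hom SetX G H"
          and comp: "Comp SetX (Arrow H (bang H) T) (under h) = Arrow G (bang G) T"
          using h B_obj[OF G] B_obj[OF H] by (simp_all add: hom_slice_iff)
        then interpret \<alpha>: nat_transf X Set G H "under (under h)"
          by (simp add: hom_functor_cat_iff)
        \<comment> \<open>In the commuting triangle both structure morphisms are identities at
          \<open>s\<close>, so the third side is one as well.\<close>
        have "under (under h) s = Ident Set (fobj K s)" if s: "s \<in> attrs" for s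
        proof -
          have "under (Comp SetX (Arrow H (bang H) T) (under h)) s = bang G s"
            by (simp only: comp arrow.sel)
          then have "Comp Set (Ident Set (fobj K s)) (under (under h) s) = Ident Set (fobj K s)"
            using attrs_Obj[OF s] bang(2)[OF G s] bang(2)[OF H s] by (simp del: set_cat_simps)
          moreover have "under (under h) s \<in> hom Set (fobj K s) (fobj K s)"
            using \<alpha>.component_in[OF attrs_Obj[OF s]] G H s by (simp add: acset_iff)
          ultimately show ?thesis using K.target.Ident_left by metis
        qed
        then show ?thesis
          using \<alpha> G H by (simp add: hom_acset_iff Obj_fiber)
      qed
      then show "under ` hom (slice_cat SetX T) (fobj B G) (fobj B H) \<subseteq> hom Acset G H"
        by blast
      show "\<forall>h\<in>hom (slice_cat SetX T) (fobj B G) (fobj B H). farr B (under h) = h"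
      proof
        fix h assume h: "h \<in> hom (slice_cat SetX T) (fobj B G) (fobj B H)"
        show "farr B (under h) = h"
          using B_arr[OF under_hom[OF h]] h B_obj[OF G] B_obj[OF H]
          by (cases h) (simp add: hom_slice_iff)
      qed
    qed
  qed
  with B_functor show ?thesis by (simp add: fully_faithful_def)
qed

end

section \<open>Limits of acsets\<close>

text \<open>Naturality along the arrow from \<open>x\<close> to \<open>None\<close> makes every leg
  of a cone equal to the leg at \<open>None\<close>, which is then the mediating morphism. This
  includes an empty \<open>J\<close>, whose own limit would be a terminal object instead of
  \<open>c\<close>.\<close>

lemma is_limit_cone_constant:
  assumes E: "cat_functor (adjoin_terminal J) D E" and c: "c \<in> Obj D"
    and obj: "\<And>x. x \<in> Obj (adjoin_terminal J) \<Longrightarrow> fobj E x = c"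
    and arr: "\<And>f. f \<in> Arr (adjoin_terminal J) \<Longrightarrow> farr E f = Ident D c"
  shows "is_limit_cone (adjoin_terminal J) D E
    \<lparr>apex = c, leg = (\<lambda>x\<in>Obj (adjoin_terminal J). Ident D c)\<rparr>" (is "is_limit_cone _ _ _ ?M")
  unfolding is_limit_cone_def
proof (intro conjI allI impI)
  interpret E: cat_functor "adjoin_terminal J" D E by fact
  note id = E.target.Ident_in[OF c]
  show "is_cone (adjoin_terminal J) D E ?M"
  proof
    fix f x y assume f: "f \<in> hom (adjoin_terminal J) x y"
    then show "Comp D (farr E f) (leg ?M x) = leg ?M y"
      using arr[of f] E.source.hom_objs[OF f] E.target.Ident_left[OF id]
      by (simp add: hom_iff del: adjoin_terminal_simps)
  qed (use c id obj in \<open>simp_all del: adjoin_terminal_simps\<close>)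
  fix N assume "is_cone (adjoin_terminal J) D E N"
  then interpret N: is_cone "adjoin_terminal J" D E N .
  have N_leg: "leg N x \<in> hom D (apex N) c" if "x \<in> Obj (adjoin_terminal J)" for x
    using N.leg_in[OF that] obj[OF that] by simp
  have N_None: "leg N x = leg N None" if x: "x \<in> Obj (adjoin_terminal J)" for x
  proof -
    have f: "To_new x \<in> hom (adjoin_terminal J) x None"
      using x by (auto simp: hom_iff)
    then have "farr E (To_new x) = Ident D c"
      using arr by (simp add: hom_iff del: adjoin_terminal_simps)
    then show ?thesis
      using N.leg_natural[OF f] E.target.Ident_left[OF N_leg[OF x]] by simp
  qed
  have None: "None \<in> Obj (adjoin_terminal J)" by simp
  show "\<exists>!u. u \<in> hom D (apex N) (apex ?M) \<and> (\<forall>x\<in>Obj (adjoin_terminal J). Comp D (leg ?M x) u = leg N x)"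
  proof (rule ex1I[of _ "leg N None"])
    show "leg N None \<in> hom D (apex N) (apex ?M) \<and>
        (\<forall>x\<in>Obj (adjoin_terminal J). Comp D (leg ?M x) (leg N None) = leg N x)"
      using N_leg[OF None] E.target.Ident_left[OF N_leg[OF None]] N_None
      by (simp del: adjoin_terminal_simps)
  next
    fix u assume "u \<in> hom D (apex N) (apex ?M) \<and>
      (\<forall>x\<in>Obj (adjoin_terminal J). Comp D (leg ?M x) u = leg N x)"
    then have u: "u \<in> hom D (apex N) c" "Comp D (Ident D c) u = leg N None"
      using None by (simp_all del: adjoin_terminal_simps)
    then show "u = leg N None" using E.target.Ident_left[OF u(1)] by simp
  qed
qed

context acset_schema
begin

text \<open>Over an attribute type the enlarged diagram of \<open>B \<circ> F\<close> is constant, so its pointwise limit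
  there can be chosen to be \<open>K\<close> itself; this makes the limit in \<open>Set\<^sup>X\<close> an acset.\<close>

lemma acset_has_limit:
  assumes F: "cat_functor J Acset F" and J: "finite_category J"
  shows "has_limit J Acset F"
proof -
  interpret F: cat_functor J Acset F by fact
  let ?A = "adjoin_terminal J"
  let ?F' = "comp_func J B F"
  let ?E = "enlarged_diagram SetX T J ?F'"
  have ff: "cat_functor Acset (slice_cat SetX T) B"
    using fully_faithful_acset_to_slice by (simp add: fully_faithful_def)
  have F': "cat_functor J (slice_cat SetX T) ?F'"
    by (rule cat_functor_comp_func[OF F ff])
  have E: "cat_functor ?A SetX ?E"
    using cat_functor_enlarged_diagram[OF F' category_functor_cat] acset_functor[OF terminal_acset] by simp
  interpret E: cat_functor ?A SetX ?E by (rule E)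
  have small: "small U (Obj ?A)"
    using finite_category_adjoin_terminal[OF J]
    by (intro small_finite[OF set_universe]) (simp only: finite_category_def)
  have Fj: "is_acset U X S K (fobj F j)" if "j \<in> Obj J" for j
    using F.fobj_Obj[OF that] by simp
  have F'_obj: "fobj ?F' j = Arrow (fobj F j) (bang (fobj F j)) T" if "j \<in> Obj J" for j
    using B_obj[OF Fj[OF that]] that by (simp add: comp_func_def compose_def)
  have F'_arr: "under (farr ?F' k) = farr F k" if "k \<in> hom J i j" for k i j
    using B_arr[OF F.farr_in[OF that]] that by (simp add: comp_func_def compose_def hom_iff)
  note E_simps = enlarged_diagram_simps[OF F']
  have const: "fobj (eval_diagram ?A ?E s) x = fobj K s" if "s \<in> attrs" "x \<in> Obj ?A" for s x
    using that Fj terminal_acset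
    by (cases x) (auto simp: eval_diagram_def E_simps F'_obj acset_iff)
  \<comment> \<open>Old arrows act by acset morphisms and arrows from old objects to the new one by
    \<open>bang\<close>; at an attribute type both are identities.\<close>
  have const_arr: "farr (eval_diagram ?A ?E s) f = Ident Set (fobj K s)"
    if s: "s \<in> attrs" and f: "f \<in> Arr ?A" for s f
  proof (cases f)
    case (Old k)
    then have "k \<in> hom J (Dom J k) (Cod J k)" using f by (auto simp: hom_iff)
    then show ?thesis
      using F.farr_in F'_arr f s Old unfolding eval_diagram_def
      by (auto simp: E_simps hom_acset_iff Obj_fiber hom_iff[of k] simp del: set_cat_simps)
  next
    case (To_new x)
    show ?thesis
    proof (cases x)
      case None
      then show ?thesis
        using To_new s terminal_acset attrs_Obj[OF s]
        by (auto simp: eval_diagram_def E_simps acset_iff simp del: set_cat_simps)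
    next
      case (Some j)
      then have "j \<in> Obj J" using f To_new by auto
      then show ?thesis
        using To_new Some s f bang(2)[OF Fj]
        by (auto simp: eval_diagram_def E_simps F'_obj simp del: set_cat_simps)
    qed
  qed
  let ?KM = "\<lambda>s. \<lparr>apex = fobj K s, leg = (\<lambda>x\<in>Obj ?A. Ident Set (fobj K s))\<rparr>"
  \<comment> \<open>Any limit will do at an ordinary object; at an attribute type the apex has to be
    the value of \<open>K\<close> itself.\<close>
  have "\<exists>M. is_limit_cone ?A Set (eval_diagram ?A ?E x) M \<and> (x \<in> attrs \<longrightarrow> M = ?KM x)"
    if x: "x \<in> Obj X" for x
  proof -
    note ev = cat_functor_eval_diagram[OF E category_set_cat x]
    show ?thesis
    proof (cases "x \<in> attrs")
      case True
      have "is_limit_cone ?A Set (eval_diagram ?A ?E x) (?KM x)"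
        by (rule is_limit_cone_constant[OF ev])
          (use True K_in_U const const_arr in \<open>simp_all del: adjoin_terminal_simps set_cat_simps(4)\<close>)
      then show ?thesis by blast
    next
      case False
      then show ?thesis
        using set_cat_has_limit[OF set_universe ev small] unfolding has_limit_def by blast
    qed
  qed
  then obtain M where M: "\<And>x. x \<in> Obj X \<Longrightarrow> is_limit_cone ?A Set (eval_diagram ?A ?E x) (M x)"
    and M_attr: "\<And>s. s \<in> attrs \<Longrightarrow> M s = ?KM s"
    using attrs_Obj by metis
  obtain L where L: "\<And>x. x \<in> Obj X \<Longrightarrow> fobj L x = apex (M x)"
    and lim: "is_limit_cone ?A SetX ?E
      \<lparr>apex = L, leg = (\<lambda>y\<in>Obj ?A. Arrow L (\<lambda>x\<in>Obj X. leg (M x) y) (fobj ?E y))\<rparr>"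
      (is "is_limit_cone _ _ _ ?\<Lambda>")
    using pointwise_limit[OF E X.category_axioms category_set_cat M] by blast
  interpret \<Lambda>: is_cone ?A SetX ?E ?\<Lambda>
    using lim by (simp add: is_limit_cone_def)
  have L_acset: "is_acset U X S K L"
    using \<Lambda>.apex_in L M_attr attrs_Obj by (simp add: acset_iff)
  have leg_attr: "(\<lambda>x\<in>Obj X. leg (M x) y) s = Ident Set (fobj K s)" if "s \<in> attrs" "y \<in> Obj ?A" for s y
    using M_attr[OF that(1)] attrs_Obj[OF that(1)] that(2) by (simp del: adjoin_terminal_simps set_cat_simps)
  \<comment> \<open>The leg at the new object is an identity at each attribute type, so uniqueness
    identifies it with \<open>bang L\<close>. Hence the apex of the lifted cone is the image of the
    acset \<open>L\<close>.\<close>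
  have "(\<lambda>x\<in>Obj X. leg (M x) None) = bang L"
  proof (rule bang_unique)
    show "nat_transf X Set L T (\<lambda>x\<in>Obj X. leg (M x) None)"
      using \<Lambda>.leg_in[of None] by (simp add: hom_functor_cat_iff E_simps)
  qed (use leg_attr in simp)
  then have top: "leg ?\<Lambda> None = fobj B L"
    by (simp add: B_obj[OF L_acset] E_simps)
  \<comment> \<open>The legs at old objects are acset morphisms, and the embedding sends this cone
    to the lift of \<open>?\<Lambda>\<close>.\<close>
  define N where "N = \<lparr>apex = L, leg = (\<lambda>j\<in>Obj J. leg ?\<Lambda> (Some j))\<rparr>"
  have leg_N: "leg N j \<in> hom Acset L (fobj F j)" if j: "j \<in> Obj J" for j
    using \<Lambda>.leg_in[of "Some j"] j Fj[OF j] L_acset leg_attr[of _ "Some j"]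
    by (simp add: N_def hom_acset_iff Obj_fiber E_simps F'_obj del: set_cat_simps)
  have N: "is_cone J Acset F N"
  proof
    show "apex N \<in> Obj Acset" using L_acset by (simp add: N_def)
    show "leg N \<in> extensional (Obj J)" by (simp add: N_def)
    show "leg N j \<in> hom Acset (apex N) (fobj F j)" if "j \<in> Obj J" for j
      using leg_N[OF that] by (simp add: N_def)
  next
    fix k i j assume k: "k \<in> hom J i j"
    then have "Old k \<in> hom ?A (Some i) (Some j)" by (simp add: hom_iff)
    from \<Lambda>.leg_natural[OF this] show "Comp Acset (farr F k) (leg N i) = leg N j"
      using k F.source.hom_objs[OF k] F'_arr[OF k]
      by (simp add: N_def E_simps(3) hom_iff del: functor_cat_simps(5))
  qed
  have "image_cone J B N = slice_lift J ?F' ?\<Lambda>"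
  proof (rule cone.equality)
    show "apex (image_cone J B N) = apex (slice_lift J ?F' ?\<Lambda>)"
      using top by (simp add: image_cone_def slice_lift_def N_def)
    have "farr B (leg N j) = Arrow (leg ?\<Lambda> None) (leg ?\<Lambda> (Some j)) (fobj ?F' j)" if j: "j \<in> Obj J" for j
      using B_arr[OF leg_N[OF j]] top j F'_obj[OF j] B_obj[OF L_acset] by (simp add: N_def)
    then show "leg (image_cone J B N) = leg (slice_lift J ?F' ?\<Lambda>)"
      by (auto simp: image_cone_def slice_lift_def intro!: restrict_ext)
  qed simp
  then have "is_limit_cone J (slice_cat SetX T) ?F' (image_cone J B N)"
    using is_limit_cone_slice_lift[OF F' lim] by simp
  from fully_faithful_reflects_limit[OF fully_faithful_acset_to_slice N this]
  show ?thesis by (auto simp: has_limit_def)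
qed

end

theorem corollary4p15:
  fixes U :: "'u set set"
    and X :: "('o, 'a) cat"
    and S :: "('o, 'a, nat, nat \<times> nat) func"
    and K :: "('o, 'a, 'u) setfunc"
  assumes "set_universe U"
    and "schema U X S"
    and "cat_functor (fiber X S 1) (set_cat U) K"
  shows "let \<A> = acset_cat U X S K; C = fiber X S 0; SetC = functor_cat C (set_cat U) in
    (\<forall>J :: ('j, 'k) cat. finite_category J \<longrightarrow> has_limits_of_shape J \<A>) \<and>
    (\<forall>D \<Phi> \<Psi>. cat_functor C (set_cat U) D \<and> inverse_functors \<A> (slice_cat SetC D) \<Phi> \<Psi> \<longrightarrow>
      (\<forall>(J :: ('j, 'k) cat) F. finite_category J \<and> cat_functor J \<A> F \<longrightarrow>
        (let F' = comp_func J \<Phi> F; Fbar = enlarged_diagram SetC D J F' in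
          has_limit (adjoin_terminal J) SetC Fbar \<and>
          (\<forall>\<Lambda>. is_limit_cone (adjoin_terminal J) SetC Fbar \<Lambda> \<longrightarrow>
            (\<exists>M. is_limit_cone J (slice_cat SetC D) F' M \<and>
                 lifts_cone SetC D J M \<Lambda> \<and>
                 (\<forall>N. is_cone J (slice_cat SetC D) F' N \<and> lifts_cone SetC D J N \<Lambda> \<longrightarrow> N = M) \<and>
                 is_limit_cone J \<A> F (image_cone J \<Psi> M))))))"
  unfolding Let_def
proof (intro conjI allI impI; (elim conjE)?)
  interpret acset_schema U X S K
    using assms by (rule acset_schema.intro)
  fix J :: "('j, 'k) cat" assume J: "finite_category J"
  show "has_limits_of_shape J (acset_cat U X S K)"
    using category_acset acset_has_limit[OF _ J] by (simp add: has_limits_of_shape_def)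
next
  let ?SetC = "functor_cat (fiber X S 0) (set_cat U)"
  fix D \<Phi> \<Psi> and J :: "('j, 'k) cat" and F
  assume D: "cat_functor (fiber X S 0) (set_cat U) D"
    and inv: "inverse_functors (acset_cat U X S K) (slice_cat ?SetC D) \<Phi> \<Psi>"
    and J: "finite_category J" and F: "cat_functor J (acset_cat U X S K) F"
  let ?F' = "comp_func J \<Phi> F"
  let ?E = "enlarged_diagram ?SetC D J ?F'"
  interpret D: cat_functor "fiber X S 0" "set_cat U" D by fact
  have F': "cat_functor J (slice_cat ?SetC D) ?F'"
    using inv by (intro cat_functor_comp_func[OF F]) (simp add: inverse_functors_def)
  have E: "cat_functor (adjoin_terminal J) ?SetC ?E"
    using cat_functor_enlarged_diagram[OF F' category_functor_cat] D by simp
  have "small U (Obj (adjoin_terminal J))"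
    using finite_category_adjoin_terminal[OF J]
    by (intro small_finite[OF assms(1)]) (simp only: finite_category_def)
  \<comment> \<open>That the fiber over 0 is a category is part of the assumption that
    \<open>D\<close> is a functor on it.\<close>
  then show "has_limit (adjoin_terminal J) ?SetC ?E"
    by (rule functor_cat_set_cat_has_limit[OF assms(1) E D.source.category_axioms])
  fix \<Lambda> assume \<Lambda>: "is_limit_cone (adjoin_terminal J) ?SetC ?E \<Lambda>"
  then have cone: "is_cone (adjoin_terminal J) ?SetC ?E \<Lambda>"
    by (simp add: is_limit_cone_def)
  have lim: "is_limit_cone J (slice_cat ?SetC D) ?F' (slice_lift J ?F' \<Lambda>)"
    by (rule is_limit_cone_slice_lift[OF F' \<Lambda>])
  \<comment> \<open>The lift \<open>slice_lift J ?F' \<Lambda>\<close> serves as \<open>M\<close> in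
    all four clauses.\<close>
  show "\<exists>M. is_limit_cone J (slice_cat ?SetC D) ?F' M \<and> lifts_cone ?SetC D J M \<Lambda> \<and>
      (\<forall>N. is_cone J (slice_cat ?SetC D) ?F' N \<and> lifts_cone ?SetC D J N \<Lambda> \<longrightarrow> N = M) \<and>
      is_limit_cone J (acset_cat U X S K) F (image_cone J \<Psi> M)"
    using lim slice_lift_lifts_cone(2,3)[OF F' cone] limit_cone_inverse_image[OF inv F lim] by blast
qed

end
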